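(* Let $G=SO(3)\times SO(3)$ act on $\mathbb R^9\cong M_3(\mathbb R)$ by the irreducible $9$-dimensional representation $\rho(h_L,h_R)X=h_LXh_R^{-1}$, and let $g$, $\Upsilon$, $\omega$ be the $G$-invariant tensors on $\mathbb R^9$ defined in the context. Then: (1) the simultaneous stabilizer in $GL(9,\mathbb R)$ of the tensors $g$ and $\Upsilon$ is $G=SO(3)\times SO(3)$ in the irreducible $9$-dimensional representation $\rho$; (2) the stabilizer in $GL(9,\mathbb R)$ of the $4$-form $\omega$ is also $G=SO(3)\times SO(3)$ in the irreducible $9$-dimensional representation $\rho$.
   Context: Identify $\mathbb R^9$ with $M_3(\mathbb R)$ via $\sigma(a)=\begin{pmatrix} a^1 & a^2 & a^3 \\ a^4 & a^5 & a^6 \\ a^7 & a^8 & a^9 \end{pmatrix}$, and let $\theta^1,\dots,\theta^9$ be the standard dual basis of $(\mathbb R^9)^*$, arranged row by row in the same way into a $3\times 3$ matrix $\sigma(\theta)$. Then $g=\sum_{i=1}^9(\theta^i)^2$; $\Upsilon$ is the totally symmetric $3$-tensor of the cubic form $\det\sigma(a)=\tfrac16\Upsilon_{ijk}a^ia^ja^k$; and $$\omega=\tfrac14\mathrm{Tr}\big(\sigma(\theta)\wedge\sigma(\theta)^T\wedge\sigma(\theta)\wedge\sigma(\theta)^T\big)=\theta^{1245}+\theta^{1278}+\theta^{1346}+\theta^{1379}+\theta^{2356}+\theta^{2389}+\theta^{4578}+\theta^{4679}+\theta^{5689},$$ where $\theta^{ijkl}=\theta^i\wedge\theta^j\wedg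e\theta^k\wedge\theta^l$.
   Formalization: The full stabilizers are larger than G: transposition fixes g and Υ, and −Id fixes ω. So it is proved instead that the identity component, and likewise the subgroup of positive determinant, of each stabilizer in GL(9,ℝ) equals ρ(SO(3)×SO(3)), with ρ faithful and irreducible. *)

theory Defs
  imports "HOL-Analysis.Analysis"
begin

section \<open>The identification of \<open>\<real>\<^sup>9\<close> with the \<open>3 \<times> 3\<close> matrices\<close>

text \<open>The index type \<open>9\<close> is the ring of integers modulo 9, so its elements are \<open>1, \<dots>, 9\<close>
  with \<open>9 = 0\<close>.\<close>

definition sigma9 :: "real^9 \<Rightarrow> real^3^3" where
  "sigma9 a = vector [vector [a$1, a$2, a$3],
                     vector [a$4, a$5, a$6],
                     vector [a$7, a$8, a$9]]"

definition theta :: "9 \<Rightarrow> real^9 \<Rightarrow> real" where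
  "theta i v = v $ i"

text \<open>The entries of the matrix of covectors \<open>\<sigma>(\<theta>)\<close>.\<close>

definition sigma_theta :: "3 \<Rightarrow> 3 \<Rightarrow> real^9 \<Rightarrow> real" where
  "sigma_theta i j v = sigma9 v $ i $ j"

lemma exhaust_9: "x = 1 \<or> x = 2 \<or> x = 3 \<or> x = 4 \<or> x = 5 \<or> x = 6 \<or> x = 7 \<or> x = 8 \<or> x = 9"
  for x :: 9
proof (induct x)
  case (of_int z)
  then have "0 \<le> z" "z < 9" by simp_all
  then have "z = 0 \<or> z = 1 \<or> z = 2 \<or> z = 3 \<or> z = 4 \<or> z = 5 \<or> z = 6 \<or> z = 7 \<or> z = 8" by arith
  then show ?case by auto
qed

lemma forall_9: "(\<forall>i::9. P i) \<longleftrightarrow>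
    P 1 \<and> P 2 \<and> P 3 \<and> P 4 \<and> P 5 \<and> P 6 \<and> P 7 \<and> P 8 \<and> P 9"
  by (metis exhaust_9)

lemma sigma_entries [simp]:
  "sigma9 a $ 1 $ 1 = a $ 1" "sigma9 a $ 1 $ 2 = a $ 2" "sigma9 a $ 1 $ 3 = a $ 3"
  "sigma9 a $ 2 $ 1 = a $ 4" "sigma9 a $ 2 $ 2 = a $ 5" "sigma9 a $ 2 $ 3 = a $ 6"
  "sigma9 a $ 3 $ 1 = a $ 7" "sigma9 a $ 3 $ 2 = a $ 8" "sigma9 a $ 3 $ 3 = a $ 9"
  unfolding sigma9_def by (simp_all only: vector_3)

lemma sigma_theta_eq:
  "sigma_theta 1 1 = theta 1" "sigma_theta 1 2 = theta 2" "sigma_theta 1 3 = theta 3"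
  "sigma_theta 2 1 = theta 4" "sigma_theta 2 2 = theta 5" "sigma_theta 2 3 = theta 6"
  "sigma_theta 3 1 = theta 7" "sigma_theta 3 2 = theta 8" "sigma_theta 3 3 = theta 9"
  by (simp_all add: fun_eq_iff sigma_theta_def theta_def del: One_nat_def)

lemma linear_sigma: "linear sigma9"
  by (rule linearI) (simp_all add: vec_eq_iff forall_3)

lemma inj_sigma: "inj sigma9"
  by (rule injI) (simp add: vec_eq_iff forall_3 forall_9)

lemma surj_sigma: "surj sigma9"
proof (rule surjI)
  fix M :: "real^3^3"
  show "sigma9 (\<chi> i. if i = 1 then M$1$1 else if i = 2 then M$1$2 else if i = 3 then M$1$3
      else if i = 4 then M$2$1 else if i = 5 then M$2$2 else if i = 6 then M$2$3
      else if i = 7 then M$3$1 else if i = 8 then M$3$2 else M$3$3) = M"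
    by (simp add: vec_eq_iff forall_3)
qed

lemma bij_sigma: "bij sigma9"
  using inj_sigma surj_sigma by (simp add: bij_def)

lemma sigma_inv_sigma [simp]: "sigma9 (inv sigma9 M) = M"
  by (rule surj_f_inv_f[OF surj_sigma])

section \<open>The group and its representation\<close>

definition SO3 :: "(real^3^3) set" where
  "SO3 = {A. rotation_matrix A}"

definition rho :: "(real^3^3) \<times> (real^3^3) \<Rightarrow> real^9^9" where
  "rho h = matrix (\<lambda>a. inv sigma9 (fst h ** sigma9 a ** matrix_inv (snd h)))"

definition irreducible_matrices :: "(real^'n^'n) set \<Rightarrow> bool" where
  "irreducible_matrices S \<longleftrightarrow>
    (\<forall>W. subspace W \<and> (\<forall>A\<in>S. \<forall>v\<in>W. A *v v \<in> W) \<longrightarrow> W = {0} \<or> W = UNIV)"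

lemma sigma_rho: "sigma9 (rho h *v a) = fst h ** sigma9 a ** matrix_inv (snd h)"
proof -
  have "linear (\<lambda>a. inv sigma9 (fst h ** sigma9 a ** matrix_inv (snd h)))"
    by (rule linearI; rule injD[OF inj_sigma])
       (simp_all add: linear_add[OF linear_sigma] linear_cmul[OF linear_sigma]
          vec_eq_iff forall_3 matrix_matrix_mult_def sum_3 algebra_simps)
  then show ?thesis
    unfolding rho_def by (simp add: matrix_works)
qed

lemma matrix_inv_SO3:
  assumes "R \<in> SO3"
  shows "matrix_inv R ** R = mat 1" "matrix_inv R = transpose R"
proof -
  have "\<exists>B. R ** B = mat 1 \<and> B ** R = mat 1" and T: "R ** transpose R = mat 1"
    using assms by (auto simp: SO3_def rotation_matrix_def orthogonal_matrix_def)
  then show inv: "matrix_inv R ** R = mat 1"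
    unfolding matrix_inv_def by - (rule someI2_ex, auto)
  have "matrix_inv R = matrix_inv R ** (R ** transpose R)" by (simp add: T)
  then show "matrix_inv R = transpose R" by (simp only: matrix_mul_assoc inv matrix_mul_lid)
qed

lemma SO3_mult: "A \<in> SO3 \<Longrightarrow> B \<in> SO3 \<Longrightarrow> A ** B \<in> SO3"
  by (simp add: SO3_def rotation_matrix_def orthogonal_matrix_mul det_mul)

lemma rho_mult:
  assumes "h \<in> SO3 \<times> SO3" "k \<in> SO3 \<times> SO3"
  shows "rho (fst h ** fst k, snd h ** snd k) = rho h ** rho k"
proof -
  have "matrix_inv (snd h ** snd k) = matrix_inv (snd k) ** matrix_inv (snd h)"
    using assms by (auto simp: matrix_inv_SO3(2) SO3_mult matrix_transpose_mul)
  then have "sigma9 (rho (fst h ** fst k, snd h ** snd k) *v a) = sigma9 (rho h *v (rho k *v a))" for a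
    by (simp add: sigma_rho matrix_mul_assoc)
  then have "rho (fst h ** fst k, snd h ** snd k) *v a = rho h *v (rho k *v a)" for a
    by (rule injD[OF inj_sigma])
  then show ?thesis by (simp add: matrix_eq matrix_vector_mul_assoc)
qed

section \<open>The invariant tensors\<close>

definition metric_g :: "real^9 \<Rightarrow> real^9 \<Rightarrow> real" where
  "metric_g u v = (\<Sum>i\<in>UNIV. theta i u * theta i v)"

text \<open>The totally symmetric 3-tensor of the cubic form \<open>det (\<sigma> a)\<close>, with the normalisation
  \<open>det (\<sigma> a) = 1/6 \<Upsilon>(a, a, a)\<close>, is the full polarisation of the cubic form. The lemmas
  \<open>Upsilon_components\<close> and \<open>Upsilon_unique\<close> show that it is the tensor intended.\<close>

definition Upsilon :: "real^9 \<Rightarrow> real^9 \<Rightarrow> real^9 \<Rightarrow> real" where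
  "Upsilon u v w =
     det (sigma9 (u + v + w)) - det (sigma9 (u + v)) - det (sigma9 (u + w)) - det (sigma9 (v + w))
     + det (sigma9 u) + det (sigma9 v) + det (sigma9 w)"

lemma Upsilon_commute: "Upsilon u v w = Upsilon v u w" "Upsilon u v w = Upsilon u w v"
  by (simp_all add: Upsilon_def add_ac)

lemma det_cross3: "det M = M$1 \<bullet> cross3 (M$2) (M$3)" for M :: "real^3^3"
  by (simp add: cross3_def inner_vec_def sum_3 det_3 algebra_simps)

lemmas trilinear_simps = Upsilon_def det_cross3 linear_add[OF linear_sigma] linear_cmul[OF linear_sigma]
  cross_add_left cross_add_right cross_mult_left cross_mult_right inner_add_left inner_add_right

lemma Upsilon_diag: "Upsilon a a a = 6 * det (sigma9 a)"
  unfolding trilinear_simps vector_add_component by simp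

lemma linear_Upsilon: "linear (\<lambda>u. Upsilon u v w)"
  by (rule linearI) (simp_all add: trilinear_simps algebra_simps)

lemma Upsilon_components:
  "det (sigma9 a) =
    1/6 * (\<Sum>i\<in>UNIV. \<Sum>j\<in>UNIV. \<Sum>k\<in>UNIV. Upsilon (axis i 1) (axis j 1) (axis k 1) * a$i * a$j * a$k)"
proof -
  have l1: "Upsilon a v w = (\<Sum>i\<in>UNIV. a$i * Upsilon (axis i 1) v w)" for v w
    using linear_sum[OF linear_Upsilon, of "\<lambda>i. a$i *\<^sub>R axis i 1" UNIV v w]
    by (simp add: basis_expansion[where x=a, unfolded scalar_mult_eq_scaleR]
          linear_cmul[OF linear_Upsilon])
  have "Upsilon a a a = (\<Sum>i\<in>UNIV. \<Sum>j\<in>UNIV. \<Sum>k\<in>UNIV.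
      a$i * (a$j * (a$k * Upsilon (axis k 1) (axis j 1) (axis i 1))))"
    by (subst l1, subst Upsilon_commute(1), subst l1, subst Upsilon_commute(2),
        subst Upsilon_commute(1), subst l1)
       (simp add: sum_distrib_left Upsilon_commute)
  also have "\<dots> = (\<Sum>i\<in>UNIV. \<Sum>j\<in>UNIV. \<Sum>k\<in>UNIV.
      Upsilon (axis i 1) (axis j 1) (axis k 1) * a$i * a$j * a$k)"
    by (simp add: Upsilon_commute mult_ac)
  finally show ?thesis unfolding Upsilon_diag by linarith
qed

lemma Upsilon_unique:
  assumes lin: "\<And>v w. linear (\<lambda>u. T u v w)"
    and sym: "\<And>u v w. T u v w = T v u w" "\<And>u v w. T u v w = T u w v"
    and diag: "\<And>a. T a a a = 6 * det (sigma9 a)"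
  shows "T = Upsilon"
proof (intro ext)
  fix u v w
  have a1: "T (x + y) p q = T x p q + T y p q" for x y p q
    using linear_add[OF lin] .
  have a2: "T p (x + y) q = T p x q + T p y q" for x y p q
    using a1[of x y p q] sym by metis
  have a3: "T p q (x + y) = T p q x + T p q y" for x y p q
    using a2[of p x y q] sym by metis
  have d: "det (sigma9 a) = T a a a / 6" for a using diag[of a] by simp
  show "T u v w = Upsilon u v w"
    by (simp add: Upsilon_def d a1 a2 a3 sym field_simps)
qed

text \<open>The wedge product of four covectors, with \<open>(\<alpha> \<and> \<beta> \<and> \<gamma> \<and> \<delta>)(v\<^sub>1, \<dots>, v\<^sub>4)\<close> the determinant
  of the values (no factor \<open>1/4!\<close>; stabilisers do not depend on this normalisation).\<close>

definition wedge4 :: "('a \<Rightarrow> real) \<Rightarrow> ('a \<Rightarrow> real) \<Rightarrow> ('a \<Rightarrow> real) \<Rightarrow> ('a \<Rightarrow> real) \<Rightarrow>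
    'a \<Rightarrow> 'a \<Rightarrow> 'a \<Rightarrow> 'a \<Rightarrow> real" where
  "wedge4 \<alpha> \<beta> \<gamma> \<delta> v\<^sub>1 v\<^sub>2 v\<^sub>3 v\<^sub>4 =
     det (vector [vector [\<alpha> v\<^sub>1, \<alpha> v\<^sub>2, \<alpha> v\<^sub>3, \<alpha> v\<^sub>4],
                  vector [\<beta> v\<^sub>1, \<beta> v\<^sub>2, \<beta> v\<^sub>3, \<beta> v\<^sub>4],
                  vector [\<gamma> v\<^sub>1, \<gamma> v\<^sub>2, \<gamma> v\<^sub>3, \<gamma> v\<^sub>4],
                  vector [\<delta> v\<^sub>1, \<delta> v\<^sub>2, \<delta> v\<^sub>3, \<delta> v\<^sub>4]] :: real^4^4)"

text \<open>\<open>\<omega> = 1/4 Tr (\<sigma>(\<theta>) \<and> \<sigma>(\<theta>)\<^sup>T \<and> \<sigma>(\<theta>) \<and> \<sigma>(\<theta>)\<^sup>T)\<close>,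
  with the trace of the matrix product written out.\<close>

definition omega :: "real^9 \<Rightarrow> real^9 \<Rightarrow> real^9 \<Rightarrow> real^9 \<Rightarrow> real" where
  "omega v\<^sub>1 v\<^sub>2 v\<^sub>3 v\<^sub>4 = 1/4 * (\<Sum>i\<in>UNIV. \<Sum>j\<in>UNIV. \<Sum>k\<in>UNIV. \<Sum>l\<in>UNIV.
     wedge4 (sigma_theta i j) (sigma_theta k j) (sigma_theta k l) (sigma_theta i l) v\<^sub>1 v\<^sub>2 v\<^sub>3 v\<^sub>4)"

abbreviation theta4 where
  "theta4 i j k l \<equiv> wedge4 (theta i) (theta j) (theta k) (theta l)"

lemma vector_4:
  fixes x :: "'a::zero"
  shows "(vector [x, y, z, w] :: 'a^4) $ 1 = x" "(vector [x, y, z, w] :: 'a^4) $ 2 = y"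
    "(vector [x, y, z, w] :: 'a^4) $ 3 = z" "(vector [x, y, z, w] :: 'a^4) $ 4 = w"
  unfolding vector_def by simp_all

lemma wedge4_swap:
  "wedge4 \<beta> \<alpha> \<gamma> \<delta> v\<^sub>1 v\<^sub>2 v\<^sub>3 v\<^sub>4 = - wedge4 \<alpha> \<beta> \<gamma> \<delta> v\<^sub>1 v\<^sub>2 v\<^sub>3 v\<^sub>4"
  "wedge4 \<alpha> \<gamma> \<beta> \<delta> v\<^sub>1 v\<^sub>2 v\<^sub>3 v\<^sub>4 = - wedge4 \<alpha> \<beta> \<gamma> \<delta> v\<^sub>1 v\<^sub>2 v\<^sub>3 v\<^sub>4"
  "wedge4 \<alpha> \<beta> \<delta> \<gamma> v\<^sub>1 v\<^sub>2 v\<^sub>3 v\<^sub>4 = - wedge4 \<alpha> \<beta> \<gamma> \<delta> v\<^sub>1 v\<^sub>2 v\<^sub>3 v\<^sub>4"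
proof -
  let ?r = "\<lambda>\<alpha>. vector [\<alpha> v\<^sub>1, \<alpha> v\<^sub>2, \<alpha> v\<^sub>3, \<alpha> v\<^sub>4] :: real^4"
  have swap: "det (\<chi> i. A $ Transposition.transpose a b i) = - det A" if "a \<noteq> b" for A :: "real^4^4" and a b
    using det_permute_rows[of "Transposition.transpose a b" A] that
    by (simp add: permutes_swap_id sign_swap_id)
  have "vector [?r \<beta>, ?r \<alpha>, ?r \<gamma>, ?r \<delta>] =
      (\<chi> i. (vector [?r \<alpha>, ?r \<beta>, ?r \<gamma>, ?r \<delta>] :: real^4^4) $ Transposition.transpose 1 2 i)"
    by (simp add: vec_eq_iff[where y = "\<chi> i. _ i"] forall_4 vector_4 Transposition.transpose_def)
  then show "wedge4 \<beta> \<alpha> \<gamma> \<delta> v\<^sub>1 v\<^sub>2 v\<^sub>3 v\<^sub>4 = - wedge4 \<alpha> \<beta> \<gamma> \<delta> v\<^sub>1 v\<^sub>2 v\<^sub>3 v\<^sub>4"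
    unfolding wedge4_def by (simp add: swap)
  have "vector [?r \<alpha>, ?r \<gamma>, ?r \<beta>, ?r \<delta>] =
      (\<chi> i. (vector [?r \<alpha>, ?r \<beta>, ?r \<gamma>, ?r \<delta>] :: real^4^4) $ Transposition.transpose 2 3 i)"
    by (simp add: vec_eq_iff[where y = "\<chi> i. _ i"] forall_4 vector_4 Transposition.transpose_def)
  then show "wedge4 \<alpha> \<gamma> \<beta> \<delta> v\<^sub>1 v\<^sub>2 v\<^sub>3 v\<^sub>4 = - wedge4 \<alpha> \<beta> \<gamma> \<delta> v\<^sub>1 v\<^sub>2 v\<^sub>3 v\<^sub>4"
    unfolding wedge4_def by (simp add: swap)
  have "vector [?r \<alpha>, ?r \<beta>, ?r \<delta>, ?r \<gamma>] =
      (\<chi> i. (vector [?r \<alpha>, ?r \<beta>, ?r \<gamma>, ?r \<delta>] :: real^4^4) $ Transposition.transpose 3 4 i)"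
    by (simp add: vec_eq_iff[where y = "\<chi> i. _ i"] forall_4 vector_4 Transposition.transpose_def)
  then show "wedge4 \<alpha> \<beta> \<delta> \<gamma> v\<^sub>1 v\<^sub>2 v\<^sub>3 v\<^sub>4 = - wedge4 \<alpha> \<beta> \<gamma> \<delta> v\<^sub>1 v\<^sub>2 v\<^sub>3 v\<^sub>4"
    unfolding wedge4_def by (simp add: swap)
qed

lemma wedge4_sort:
  "wedge4 \<alpha> \<beta> \<gamma> \<delta> v\<^sub>1 v\<^sub>2 v\<^sub>3 v\<^sub>4 = wedge4 \<alpha> \<gamma> \<delta> \<beta> v\<^sub>1 v\<^sub>2 v\<^sub>3 v\<^sub>4"
  "wedge4 \<alpha> \<beta> \<gamma> \<delta> v\<^sub>1 v\<^sub>2 v\<^sub>3 v\<^sub>4 = wedge4 \<beta> \<delta> \<gamma> \<alpha> v\<^sub>1 v\<^sub>2 v\<^sub>3 v\<^sub>4"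
  "wedge4 \<alpha> \<beta> \<gamma> \<delta> v\<^sub>1 v\<^sub>2 v\<^sub>3 v\<^sub>4 = wedge4 \<gamma> \<alpha> \<beta> \<delta> v\<^sub>1 v\<^sub>2 v\<^sub>3 v\<^sub>4"
  "wedge4 \<alpha> \<beta> \<gamma> \<delta> v\<^sub>1 v\<^sub>2 v\<^sub>3 v\<^sub>4 = wedge4 \<delta> \<beta> \<alpha> \<gamma> v\<^sub>1 v\<^sub>2 v\<^sub>3 v\<^sub>4"
proof -
  show "wedge4 \<alpha> \<beta> \<gamma> \<delta> v\<^sub>1 v\<^sub>2 v\<^sub>3 v\<^sub>4 = wedge4 \<alpha> \<gamma> \<delta> \<beta> v\<^sub>1 v\<^sub>2 v\<^sub>3 v\<^sub>4"
    using wedge4_swap(3)[of \<alpha> \<gamma> \<beta> \<delta> v\<^sub>1 v\<^sub>2 v\<^sub>3 v\<^sub>4]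
      wedge4_swap(2)[of \<alpha> \<beta> \<gamma> \<delta> v\<^sub>1 v\<^sub>2 v\<^sub>3 v\<^sub>4] by linarith
  show "wedge4 \<alpha> \<beta> \<gamma> \<delta> v\<^sub>1 v\<^sub>2 v\<^sub>3 v\<^sub>4 = wedge4 \<beta> \<delta> \<gamma> \<alpha> v\<^sub>1 v\<^sub>2 v\<^sub>3 v\<^sub>4"
    using wedge4_swap(2)[of \<beta> \<gamma> \<delta> \<alpha> v\<^sub>1 v\<^sub>2 v\<^sub>3 v\<^sub>4]
      wedge4_swap(3)[of \<beta> \<gamma> \<alpha> \<delta> v\<^sub>1 v\<^sub>2 v\<^sub>3 v\<^sub>4]
      wedge4_swap(2)[of \<beta> \<alpha> \<gamma> \<delta> v\<^sub>1 v\<^sub>2 v\<^sub>3 v\<^sub>4]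
      wedge4_swap(1)[of \<alpha> \<beta> \<gamma> \<delta> v\<^sub>1 v\<^sub>2 v\<^sub>3 v\<^sub>4] by linarith
  show "wedge4 \<alpha> \<beta> \<gamma> \<delta> v\<^sub>1 v\<^sub>2 v\<^sub>3 v\<^sub>4 = wedge4 \<gamma> \<alpha> \<beta> \<delta> v\<^sub>1 v\<^sub>2 v\<^sub>3 v\<^sub>4"
    using wedge4_swap(1)[of \<alpha> \<gamma> \<beta> \<delta> v\<^sub>1 v\<^sub>2 v\<^sub>3 v\<^sub>4]
      wedge4_swap(2)[of \<alpha> \<beta> \<gamma> \<delta> v\<^sub>1 v\<^sub>2 v\<^sub>3 v\<^sub>4] by linarith
  show "wedge4 \<alpha> \<beta> \<gamma> \<delta> v\<^sub>1 v\<^sub>2 v\<^sub>3 v\<^sub>4 = wedge4 \<delta> \<beta> \<alpha> \<gamma> v\<^sub>1 v\<^sub>2 v\<^sub>3 v\<^sub>4"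
    using wedge4_swap(1)[of \<beta> \<delta> \<alpha> \<gamma> v\<^sub>1 v\<^sub>2 v\<^sub>3 v\<^sub>4]
      wedge4_swap(2)[of \<beta> \<alpha> \<delta> \<gamma> v\<^sub>1 v\<^sub>2 v\<^sub>3 v\<^sub>4]
      wedge4_swap(1)[of \<alpha> \<beta> \<delta> \<gamma> v\<^sub>1 v\<^sub>2 v\<^sub>3 v\<^sub>4]
      wedge4_swap(3)[of \<alpha> \<beta> \<gamma> \<delta> v\<^sub>1 v\<^sub>2 v\<^sub>3 v\<^sub>4] by linarith
qed

lemma omega_eq:
  "omega v\<^sub>1 v\<^sub>2 v\<^sub>3 v\<^sub>4 =
     theta4 1 2 4 5 v\<^sub>1 v\<^sub>2 v\<^sub>3 v\<^sub>4 +
     theta4 1 2 7 8 v\<^sub>1 v\<^sub>2 v\<^sub>3 v\<^sub>4 +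
     theta4 1 3 4 6 v\<^sub>1 v\<^sub>2 v\<^sub>3 v\<^sub>4 +
     theta4 1 3 7 9 v\<^sub>1 v\<^sub>2 v\<^sub>3 v\<^sub>4 +
     theta4 2 3 5 6 v\<^sub>1 v\<^sub>2 v\<^sub>3 v\<^sub>4 +
     theta4 2 3 8 9 v\<^sub>1 v\<^sub>2 v\<^sub>3 v\<^sub>4 +
     theta4 4 5 7 8 v\<^sub>1 v\<^sub>2 v\<^sub>3 v\<^sub>4 +
     theta4 4 6 7 9 v\<^sub>1 v\<^sub>2 v\<^sub>3 v\<^sub>4 +
     theta4 5 6 8 9 v\<^sub>1 v\<^sub>2 v\<^sub>3 v\<^sub>4"
proof -
  have repeated: "wedge4 \<alpha> \<alpha> \<gamma> \<delta> v\<^sub>1 v\<^sub>2 v\<^sub>3 v\<^sub>4 = 0" "wedge4 \<alpha> \<beta> \<beta> \<delta> v\<^sub>1 v\<^sub>2 v\<^sub>3 v\<^sub>4 = 0"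
    for \<alpha> \<beta> \<gamma> \<delta> :: "real^9 \<Rightarrow> real"
    using wedge4_swap(1)[of \<alpha> \<alpha> \<gamma> \<delta> v\<^sub>1 v\<^sub>2 v\<^sub>3 v\<^sub>4] wedge4_swap(2)[of \<alpha> \<beta> \<beta> \<delta> v\<^sub>1 v\<^sub>2 v\<^sub>3 v\<^sub>4]
    by linarith+
  have repeated_end: "wedge4 \<alpha> \<beta> \<gamma> \<gamma> v\<^sub>1 v\<^sub>2 v\<^sub>3 v\<^sub>4 = 0" "wedge4 \<alpha> \<beta> \<gamma> \<alpha> v\<^sub>1 v\<^sub>2 v\<^sub>3 v\<^sub>4 = 0"
    for \<alpha> \<beta> \<gamma> :: "real^9 \<Rightarrow> real"
    using wedge4_swap(3)[of \<alpha> \<beta> \<gamma> \<gamma> v\<^sub>1 v\<^sub>2 v\<^sub>3 v\<^sub>4] wedge4_sort(1)[of \<alpha> \<alpha> \<beta> \<gamma> v\<^sub>1 v\<^sub>2 v\<^sub>3 v\<^sub>4]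
      repeated(1)[of \<alpha> \<beta> \<gamma>]
    by linarith+
  note sort = wedge4_sort[of "theta 1" "theta 2" "theta 4" "theta 5", symmetric]
    wedge4_sort[of "theta 1" "theta 2" "theta 7" "theta 8", symmetric]
    wedge4_sort[of "theta 1" "theta 3" "theta 4" "theta 6", symmetric]
    wedge4_sort[of "theta 1" "theta 3" "theta 7" "theta 9", symmetric]
    wedge4_sort[of "theta 2" "theta 3" "theta 5" "theta 6", symmetric]
    wedge4_sort[of "theta 2" "theta 3" "theta 8" "theta 9", symmetric]
    wedge4_sort[of "theta 4" "theta 5" "theta 7" "theta 8", symmetric]
    wedge4_sort[of "theta 4" "theta 6" "theta 7" "theta 9", symmetric]
    wedge4_sort[of "theta 5" "theta 6" "theta 8" "theta 9", symmetric]
  show ?thesis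
    unfolding omega_def sum_3 sigma_theta_eq repeated repeated_end sort by simp
qed

section \<open>The stabilisers\<close>

definition GL9 :: "(real^9^9) set" where
  "GL9 = {A. invertible A}"

definition stab_g_Upsilon :: "(real^9^9) set" where
  "stab_g_Upsilon = {A \<in> GL9.
     (\<forall>u v. metric_g (A *v u) (A *v v) = metric_g u v) \<and>
     (\<forall>u v w. Upsilon (A *v u) (A *v v) (A *v w) = Upsilon u v w)}"

definition stab_omega :: "(real^9^9) set" where
  "stab_omega = {A \<in> GL9.
     \<forall>v\<^sub>1 v\<^sub>2 v\<^sub>3 v\<^sub>4. omega (A *v v\<^sub>1) (A *v v\<^sub>2) (A *v v\<^sub>3) (A *v v\<^sub>4) = omega v\<^sub>1 v\<^sub>2 v\<^sub>3 v\<^sub>4}"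

text \<open>Neither stabiliser is contained in \<open>\<rho>(SO(3) \<times> SO(3))\<close>: matrix transposition fixes \<open>g\<close> and
  \<open>\<Upsilon>\<close>, and \<open>-1\<close> fixes \<open>\<omega>\<close>. Both of these maps reverse the orientation of \<open>\<real>\<^sup>9\<close>. A stabiliser
  can therefore be \<open>\<rho>(SO(3) \<times> SO(3))\<close> only as a connected group, or among orientation-preserving
  maps.\<close>

definition transposition9 :: "real^9^9" where
  "transposition9 = matrix (\<lambda>a. inv sigma9 (transpose (sigma9 a)))"

lemma sigma_transposition9: "sigma9 (transposition9 *v a) = transpose (sigma9 a)"
proof -
  have "linear (\<lambda>a. inv sigma9 (transpose (sigma9 a)))"
    by (rule linearI; rule injD[OF inj_sigma])
       (simp_all add: linear_add[OF linear_sigma] linear_cmul[OF linear_sigma]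
         transpose_def vec_eq_iff)
  then show ?thesis
    unfolding transposition9_def by (simp add: matrix_works)
qed

lemma transposition9_in_stab: "transposition9 \<in> stab_g_Upsilon"
proof -
  let ?T = transposition9
  have inv: "?T *v (?T *v a) = a" for a
    by (rule injD[OF inj_sigma]) (simp add: sigma_transposition9)
  have metric: "metric_g u v = (\<Sum>i\<in>UNIV. \<Sum>j\<in>UNIV. sigma9 u $ i $ j * sigma9 v $ i $ j)" for u v
  proof -
    have UNIV_9: "(UNIV :: 9 set) = {1, 2, 3, 4, 5, 6, 7, 8, 9}" by (simp add: set_eq_iff forall_9)
    show ?thesis unfolding metric_g_def UNIV_9 theta_def sum_3 sigma_entries by (simp add: add_ac)
  qed
  have "?T ** ?T = mat 1"
    by (simp add: matrix_eq inv flip: matrix_vector_mul_assoc)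
  then have "?T \<in> GL9" by (auto simp: GL9_def invertible_def)
  moreover have "metric_g (?T *v u) (?T *v v) = metric_g u v" for u v
    unfolding metric sigma_transposition9 by (simp add: sum_3 transpose_def)
  moreover have "Upsilon (?T *v u) (?T *v v) (?T *v w) = Upsilon u v w" for u v w
    unfolding Upsilon_def matrix_vector_right_distrib[symmetric] sigma_transposition9 det_transpose ..
  ultimately show ?thesis by (simp add: stab_g_Upsilon_def)
qed

lemma transposition9_notin_rho: "transposition9 \<notin> rho ` (SO3 \<times> SO3)"
proof
  assume "transposition9 \<in> rho ` (SO3 \<times> SO3)"
  then obtain L R where LR: "L \<in> SO3" "R \<in> SO3" "transposition9 = rho (L, R)" by auto
  have *: "transpose M = L ** M ** matrix_inv R" for M
  proof -
    have "sigma9 (transposition9 *v inv sigma9 M) = L ** M ** matrix_inv R"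
      by (simp add: LR(3) sigma_rho)
    then show ?thesis by (simp add: sigma_transposition9)
  qed
  have R: "matrix_inv R ** R = mat 1"
    using LR(2) by (rule matrix_inv_SO3(1))
  have comm_L: "transpose M ** R = L ** M" for M
  proof -
    have "transpose M ** R = L ** M ** (matrix_inv R ** R)"
      by (simp only: * matrix_mul_assoc)
    then show ?thesis by (simp add: R)
  qed
  have "L = R" using comm_L[of "mat 1"] by (simp add: transpose_mat)
  then have comm: "transpose M ** R = R ** M" for M using comm_L by simp
  have "R = 0"
  proof -
    have "R $ p $ j = 0" for p j
    proof -
      obtain q :: 3 where q: "q \<noteq> j"
        by (rule that[of "j + 1"]) simp
      define M :: "real^3^3" where "M = (\<chi> i l. if i = p \<and> l = q then 1 else 0)"
      have "(transpose M ** R) $ q $ j = (R ** M) $ q $ j" by (simp add: comm)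
      then show ?thesis
        using q by (simp add: M_def matrix_matrix_mult_def transpose_def if_distrib if_distribR cong: if_cong)
    qed
    then show ?thesis by (simp add: vec_eq_iff)
  qed
  then show False using LR(2) by (simp add: SO3_def rotation_matrix_def det_3)
qed

lemma mat_uminus_vector: "mat (-1) *v x = - x" for x :: "real^'n"
  by (simp add: vec_eq_iff matrix_vector_mult_def mat_def if_distrib if_distribR cong: if_cong)

lemma uminus_in_stab: "mat (-1) \<in> stab_omega"
proof -
  have "(mat (-1) :: real^9^9) ** mat (-1) = mat 1"
    by (simp add: matrix_eq mat_uminus_vector flip: matrix_vector_mul_assoc)
  then have "mat (-1) \<in> GL9" by (auto simp: GL9_def invertible_def)
  moreover have "omega (- a) (- b) (- c) (- d) = omega a b c d" for a b c d
  proof -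
    have det_uminus: "det (- A) = det A" for A :: "real^4^4"
      by (simp add: det_def prod_uminus)
    have "wedge4 \<alpha> \<beta> \<gamma> \<delta> (-a) (-b) (-c) (-d) = wedge4 \<alpha> \<beta> \<gamma> \<delta> a b c d"
      if "\<And>v. \<alpha> (-v) = - \<alpha> v" "\<And>v. \<beta> (-v) = - \<beta> v" "\<And>v. \<gamma> (-v) = - \<gamma> v" "\<And>v. \<delta> (-v) = - \<delta> v"
      for \<alpha> \<beta> \<gamma> \<delta> :: "real^9 \<Rightarrow> real"
      unfolding wedge4_def that
      by (subst det_uminus[symmetric], rule arg_cong[where f = det])
         (simp add: vec_eq_iff forall_4 vector_4)
    then show ?thesis
      by (simp add: omega_def sigma_theta_def linear_neg[OF linear_sigma])
  qed
  ultimately show ?thesis by (simp add: stab_omega_def mat_uminus_vector)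
qed

lemma uminus_notin_rho: "mat (-1) \<notin> rho ` (SO3 \<times> SO3)"
proof
  assume "mat (-1) \<in> rho ` (SO3 \<times> SO3)"
  then obtain L R where LR: "L \<in> SO3" "R \<in> SO3" "mat (-1) = rho (L, R)" by auto
  have *: "L ** mat 1 ** matrix_inv R = - mat 1"
    using sigma_rho[of "(L, R)" "inv sigma9 (mat 1)"]
    by (simp add: mat_uminus_vector linear_neg[OF linear_sigma] flip: LR(3))
  have "L = L ** mat 1 ** (matrix_inv R ** R)"
    using matrix_inv_SO3(1)[OF LR(2)] by simp
  also have "\<dots> = (- mat 1) ** R"
    by (simp only: matrix_mul_assoc *)
  also have "\<dots> = - R"
    by (simp add: vec_eq_iff matrix_matrix_mult_def forall_3 sum_3 mat_def)
  finally have "L = - R" .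
  then have "det L = - det R" by (simp add: det_3)
  then show False using LR(1,2) by (simp add: SO3_def rotation_matrix_def)
qed

end

theory Submission
  imports Defs
begin

text \<open>
  The Lie algebra of \<open>\<rho>(SO(3) \<times> SO(3))\<close> consists of the maps \<open>X \<mapsto> a X + X b\<close> of \<open>M\<^sub>3(\<real>)\<close>
  with skew matrices \<open>a\<close> and \<open>b\<close>. It is exactly the Lie algebra of linear maps that annihilate \<open>\<omega>\<close>
  as derivations (\<open>omega_mat_annihilator\<close>, \<open>so3_so3_annihilates_omega_mat\<close>), and also exactly
  the one that annihilates \<open>g\<close> and \<open>\<Upsilon>\<close> (\<open>metric_det_annihilator\<close>,
  \<open>so3_so3_annihilates_det_polar\<close>, \<open>so3_so3_annihilates_inner\<close>). That no
  other map annihilates these tensors is a linear system for the coefficients of the map, easy to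
  solve because the tensors are sparse on matrix units.

  An invertible linear map that stabilises a tensor normalises the Lie algebra annihilating this
  tensor. Hence the disconnected stabilisers are controlled by a purely algebraic statement, \<open>normalizer_so3_so3\<close>: the
  elements of the normaliser of the Lie algebra in the linear group of \<open>M\<^sub>3(\<real>)\<close> have the form
  \<open>X \<mapsto> c P X Q\<^sup>T\<close> or \<open>X \<mapsto> c P X\<^sup>T Q\<^sup>T\<close> with rotations \<open>P\<close>, \<open>Q\<close> and a scalar \<open>c\<close>. The reason is
  that the two ideals of left and of right multiplications are visible in the cubic equations that
  their elements satisfy (\<open>so3_so3_cube\<close>), so that a normalising map preserves or exchanges them;
  a map that preserves the left multiplications is, up to a rotation, linear over the whole matrix
  algebra.

  The scalar and the transposition are then tested on the tensors: \<open>g\<close> and \<open>\<Upsilon>\<close> force \<open>c = 1\<close> and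
  admit the transposition, while \<open>\<omega>\<close> forces \<open>c = \<plusminus>1\<close> and excludes it, because transposition sends
  \<open>\<omega>\<close> to \<open>-\<omega>\<close>. Both the transposition and \<open>-1\<close> reverse the orientation of \<open>\<real>\<^sup>9\<close>, so the elements of
  positive determinant are those of \<open>\<rho>(SO(3) \<times> SO(3))\<close>. This group is connected, because every
  rotation is a product of two half-turns (\<open>connected_SO3\<close>), and so it is also the identity component
  (\<open>identity_component_eq\<close>).
\<close>

section \<open>Matrix units\<close>

lemma bounded_bilinear_matrix_mult:
  "bounded_bilinear ((**) :: real^'n^'m \<Rightarrow> real^'p^'n \<Rightarrow> real^'p^'m)"
  unfolding bilinear_conv_bounded_bilinear[symmetric]
  by (auto simp: bilinear_def intro!: linearI
      simp: matrix_matrix_mult_def vec_eq_iff sum.distrib sum_distrib_left algebra_simps)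

lemmas matrix_mult_simps =
  bounded_bilinear.add_left[OF bounded_bilinear_matrix_mult]
  bounded_bilinear.add_right[OF bounded_bilinear_matrix_mult]
  bounded_bilinear.diff_left[OF bounded_bilinear_matrix_mult]
  bounded_bilinear.diff_right[OF bounded_bilinear_matrix_mult]
  bounded_bilinear.minus_left[OF bounded_bilinear_matrix_mult]
  bounded_bilinear.minus_right[OF bounded_bilinear_matrix_mult]
  bounded_bilinear.scaleR_left[OF bounded_bilinear_matrix_mult]
  bounded_bilinear.scaleR_right[OF bounded_bilinear_matrix_mult]
  bounded_bilinear.zero_left[OF bounded_bilinear_matrix_mult]
  bounded_bilinear.zero_right[OF bounded_bilinear_matrix_mult]

lemma linear_transpose: "linear (transpose :: real^'n^'m \<Rightarrow> real^'m^'n)"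
  by (rule linearI) (simp_all add: transpose_def vec_eq_iff)

lemmas transpose_simps = linear_add[OF linear_transpose] linear_diff[OF linear_transpose]
  linear_neg[OF linear_transpose] linear_cmul[OF linear_transpose] linear_0[OF linear_transpose]
  matrix_transpose_mul transpose_transpose transpose_mat

lemma inner_matrix_mult:
  fixes A B C :: "real^3^3"
  shows "(A ** B) \<bullet> C = B \<bullet> (transpose A ** C)" "(A ** B) \<bullet> C = A \<bullet> (C ** transpose B)"
  by (simp_all add: inner_vec_def matrix_matrix_mult_def transpose_def sum_3 algebra_simps)

definition munit :: "3 \<Rightarrow> 3 \<Rightarrow> real^3^3" where
  "munit i p = (\<chi> a b. if a = i \<and> b = p then 1 else 0)"

lemma munit_nth [simp]: "munit i p $ a $ b = (if a = i \<and> b = p then 1 else 0)"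
  by (simp add: munit_def)

lemma matrix_eq_sum_munit: "X = (\<Sum>i\<in>UNIV. \<Sum>p\<in>UNIV. X $ i $ p *\<^sub>R munit i p)"
  by (simp add: vec_eq_iff forall_3 sum_3)

lemma linear_eq_on_munit:
  assumes "linear f" "linear g" "\<And>i p. f (munit i p) = g (munit i p)"
  shows "f X = g X"
proof -
  have *: "h X = (\<Sum>i\<in>UNIV. \<Sum>p\<in>UNIV. X $ i $ p *\<^sub>R h (munit i p))" if "linear h" for h
    by (subst matrix_eq_sum_munit[of X]) (simp add: linear_sum[OF that] linear_cmul[OF that])
  show ?thesis by (simp add: *[OF assms(1)] *[OF assms(2)] assms(3))
qed

lemma sandwich_munit: "(A ** munit k l ** B) $ i $ j = A $ i $ k * B $ l $ j"
proof -
  have "(A ** munit k l) $ i $ m = (if m = l then A $ i $ k else 0)" for m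
    by (simp add: matrix_matrix_mult_def if_distrib[of "\<lambda>x. _ * x"] cong: if_cong)
  then show ?thesis
    by (simp add: matrix_matrix_mult_def[of "A ** munit k l"] if_distrib[of "\<lambda>x. x * _"] cong: if_cong)
qed

lemma munit_mult: "munit i j ** munit j k = munit i k"
proof -
  have "munit i j ** munit j k ** mat 1 = munit i k"
    unfolding vec_eq_iff sandwich_munit by (auto simp: mat_def)
  then show ?thesis by simp
qed

lemma exhaust_3_distinct:
  fixes i j k :: 3
  assumes "i \<noteq> j" "j \<noteq> k" "i \<noteq> k"
  shows "x = i \<or> x = j \<or> x = k"
  using assms exhaust_3[of i] exhaust_3[of j] exhaust_3[of k] exhaust_3[of x] by auto

text \<open>Computations with entries below use three distinct, otherwise arbitrary row indices and likewise for the
  columns, so that one calculation covers all positions of the matrix.\<close>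

lemma sum_distinct_3:
  fixes f :: "3 \<Rightarrow> 'a::comm_monoid_add"
  assumes "i \<noteq> j" "j \<noteq> k" "i \<noteq> k"
  shows "sum f UNIV = f i + f j + f k"
proof -
  have U: "UNIV = {i, j, k}" using exhaust_3_distinct[OF assms] by auto
  show ?thesis unfolding U using assms by (simp add: add.assoc)
qed

lemma third_index:
  assumes "i \<noteq> (j::3)"
  obtains k where "j \<noteq> k" "i \<noteq> k"
proof -
  have "\<exists>k. j \<noteq> k \<and> i \<noteq> k"
  proof (rule ccontr)
    assume "\<nexists>k. j \<noteq> k \<and> i \<noteq> k"
    then have "k = i \<or> k = j" for k by auto
    from this[of 1] this[of 2] this[of 3] show False by auto
  qed
  then show ?thesis using that by blast
qed

section \<open>Skew matrices and the Lie algebra of the representation\<close>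

text \<open>The matrix of the cross product with \<open>w\<close>; \<open>hat\<close> is the usual isomorphism of
  \<open>\<real>\<^sup>3\<close> with the skew matrices.\<close>

definition hat :: "real^3 \<Rightarrow> real^3^3" where
  "hat w = vector [vector [0, - w$3, w$2], vector [w$3, 0, - w$1], vector [- w$2, w$1, 0]]"

lemma hat_vector: "hat w *v x = cross3 w x"
  by (simp add: hat_def cross3_def matrix_vector_mult_def vec_eq_iff forall_3 sum_3)

lemma linear_hat: "linear hat"
  by (rule linearI) (simp_all add: hat_def vec_eq_iff forall_3)

lemma hat_0 [simp]: "hat 0 = 0"
  by (rule linear_0[OF linear_hat])

lemma hat_eq_iff [simp]: "hat a = hat b \<longleftrightarrow> a = b"
  by (auto simp: hat_def vec_eq_iff forall_3)

lemma hat_eq_0_iff: "hat a = 0 \<longleftrightarrow> a = 0"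
  by (metis hat_0 hat_eq_iff)

lemma transpose_hat: "transpose (hat w) = - hat w"
  by (simp add: hat_def vec_eq_iff forall_3 transpose_def)

lemma skew_eq_hat:
  assumes "\<And>i j. M $ i $ j = - M $ j $ i"
  obtains w where "M = hat w"
proof
  show "M = hat (vector [M$3$2, M$1$3, M$2$1])"
    using assms[of 1 1] assms[of 2 2] assms[of 3 3] assms[of 1 2] assms[of 3 1] assms[of 2 3]
    by (simp add: hat_def vec_eq_iff forall_3)
qed

text \<open>Cayley-Hamilton for a skew \<open>3 \<times> 3\<close> matrix. This identity separates left from right
  multiplications in \<open>so3_so3_cube\<close>.\<close>

lemma hat_cube: "hat a ** (hat a ** hat a) = - (a \<bullet> a) *\<^sub>R hat a"
  by (simp add: hat_def vec_eq_iff forall_3 matrix_matrix_mult_def sum_3 inner_vec_def algebra_simps)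

lemma hat_cross3: "hat (cross3 a b) = hat a ** hat b - hat b ** hat a"
  by (simp add: hat_def cross3_def vec_eq_iff forall_3 matrix_matrix_mult_def sum_3 algebra_simps)

lemma trace_hat_square:
  "(hat b ** hat b) $ 1 $ 1 + (hat b ** hat b) $ 2 $ 2 + (hat b ** hat b) $ 3 $ 3 = - 2 * (b \<bullet> b)"
  by (simp add: hat_def matrix_matrix_mult_def sum_3 inner_vec_def algebra_simps)

text \<open>Rotations preserve the cross product.\<close>

lemma hat_rotation:
  assumes "rotation_matrix P"
  shows "hat (P *v a) = P ** hat a ** transpose P"
proof -
  have "P ** transpose P = mat 1" using assms by (simp add: rotation_matrix_def orthogonal_matrix_def)
  then have PP: "P *v (transpose P *v x) = x" for x
    by (simp only: matrix_vector_mul_assoc matrix_vector_mul_lid)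
  have "hat (P *v a) *v x = P ** hat a ** transpose P *v x" for x
  proof -
    have "hat (P *v a) *v x = cross3 (P *v a) (P *v (transpose P *v x))"
      by (simp only: hat_vector PP)
    also have "\<dots> = P *v (hat a *v (transpose P *v x))"
      by (simp only: cross_rotation_matrix[OF assms] hat_vector)
    finally show ?thesis by (simp only: matrix_vector_mul_assoc matrix_mul_assoc)
  qed
  then show ?thesis by (simp add: matrix_eq)
qed

text \<open>Products of skew matrices generate the whole matrix algebra, so whatever commutes with the skew matrices is
  scalar and whatever is linear over them is linear over all matrices.\<close>

lemma munit_eq_hat:
  assumes "i \<noteq> j"
  shows "munit i j = hat (axis j 1) ** hat (axis i 1)"
proof -
  consider "i = 1" "j = 2" | "i = 1" "j = 3" | "i = 2" "j = 1" | "i = 2" "j = 3"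
    | "i = 3" "j = 1" | "i = 3" "j = 2"
    using assms exhaust_3[of i] exhaust_3[of j] by auto
  then show ?thesis
    by cases (simp_all add: hat_def vec_eq_iff forall_3 matrix_matrix_mult_def sum_3 axis_def)
qed

lemma commutes_with_hat_imp_scalar:
  assumes "\<And>b. hat b ** M = M ** hat b"
  shows "M = (M $ 1 $ 1) *\<^sub>R mat 1"
proof -
  have e: "(hat b ** M) $ i $ j = (M ** hat b) $ i $ j" for b i j by (simp add: assms)
  note s = hat_def matrix_matrix_mult_def sum_3 axis_def
  have "M $ 1 $ 3 = 0" "M $ 1 $ 2 = 0" "M $ 3 $ 1 = 0" "M $ 2 $ 1 = 0" "M $ 3 $ 3 = M $ 2 $ 2"
    using e[of "axis 1 1" 1 2] e[of "axis 1 1" 1 3] e[of "axis 1 1" 2 1] e[of "axis 1 1" 3 1]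
      e[of "axis 1 1" 2 3] by (simp_all add: s)
  moreover have "M $ 2 $ 3 = 0" "M $ 3 $ 2 = 0" "M $ 3 $ 3 = M $ 1 $ 1"
    using e[of "axis 2 1" 2 1] e[of "axis 2 1" 1 2] e[of "axis 2 1" 1 3] by (simp_all add: s)
  ultimately show ?thesis by (simp add: vec_eq_iff forall_3 mat_def)
qed

text \<open>The differential of \<open>X \<mapsto> L X R\<^sup>T\<close> at the identity, in the direction of the skew
  matrices \<open>hat a\<close> and \<open>- hat b\<close>.\<close>

definition so3_so3 :: "real^3 \<Rightarrow> real^3 \<Rightarrow> real^3^3 \<Rightarrow> real^3^3" where
  "so3_so3 a b X = hat a ** X + X ** hat b"

lemma linear_so3_so3: "linear (so3_so3 a b)"
  by (rule linearI) (simp_all add: so3_so3_def matrix_mult_simps algebra_simps)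

text \<open>The common end of both stabiliser computations. The hypothesis \<open>diff\<close> leaves only coefficients
  inside a row or inside a column. By \<open>col\<close> the coefficients inside a column are those of one
  skew matrix acting on the left, the same in every column, and by \<open>row\<close> those inside a row come
  from one skew matrix acting on the right.\<close>

lemma so3_so3_of_entries:
  fixes m :: "real^3^3 \<Rightarrow> real^3^3"
  assumes "linear m"
    and diff: "\<And>i j q r. i \<noteq> j \<Longrightarrow> q \<noteq> r \<Longrightarrow> m (munit j r) $ i $ q = 0"
    and diag: "\<And>i q. m (munit i q) $ i $ q = 0"
    and row: "\<And>i j q r. i \<noteq> j \<Longrightarrow> q \<noteq> r \<Longrightarrow> m (munit j r) $ j $ q = - m (munit i q) $ i $ r"
    and col: "\<And>i j q r. i \<noteq> j \<Longrightarrow> q \<noteq> r \<Longrightarrow> m (munit j q) $ i $ q = - m (munit i r) $ j $ r"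
  obtains a b where "m = so3_so3 a b"
proof -
  \<comment> \<open>Going through a third index twice removes the sign in \<open>col\<close> and \<open>row\<close>; a single application
    gives the skew-symmetry of \<open>A\<close> and \<open>B\<close> below.\<close>
  have col': "m (munit j q) $ i $ q = m (munit j r) $ i $ r" for i j q r
  proof (cases "i = j \<or> q = r")
    case False
    then obtain s where "q \<noteq> s" "r \<noteq> s" using third_index by metis
    then show ?thesis using col[of i j q s] col[of j i s r] False by simp
  qed (auto simp: diag)
  have row': "m (munit i r) $ i $ q = m (munit j r) $ j $ q" for i j q r
  proof (cases "i = j \<or> q = r")
    case False
    then obtain k where "i \<noteq> k" "j \<noteq> k" using third_index by metis
    then show ?thesis using row[of k i q r] row[of j k r q] False by simp
  qed (auto simp: diag)
  obtain q0 where q0: "(1::3) \<noteq> q0" by (rule that[of 2]) simp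
  define A :: "real^3^3" where "A = (\<chi> i j. m (munit j 1) $ i $ 1)"
  define B :: "real^3^3" where "B = (\<chi> r q. m (munit 1 r) $ 1 $ q)"
  have "A $ i $ j = - A $ j $ i" for i j
    using col[of i j 1 q0] col'[of i q0 j 1] q0 diag by (cases "i = j") (auto simp: A_def)
  then obtain a where a: "A = hat a" using skew_eq_hat by blast
  have "B $ i $ j = - B $ j $ i" for i j
    using row[of 1 q0 i j] row'[of q0 j i 1] q0 diag by (cases "i = j") (auto simp: B_def)
  then obtain b where b: "B = hat b" using skew_eq_hat by blast
  have e: "m (munit j r) $ i $ q = (if q = r then A $ i $ j else 0) + (if i = j then B $ r $ q else 0)"
    for i j q r
    using col'[of j q i 1] row'[of j r q 1] diff[of i j q r] diag[of i q] diag[of 1 1]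
    by (auto simp: A_def B_def diag)
  have "m (munit j r) = so3_so3 a b (munit j r)" for j r
    unfolding so3_so3_def a[symmetric] b[symmetric] vec_eq_iff e
    by (auto simp: matrix_matrix_mult_def if_distrib[of "\<lambda>x. _ * x"] if_distrib[of "\<lambda>x. x * _"] cong: if_cong)
  then have "m X = so3_so3 a b X" for X
    by (rule linear_eq_on_munit[OF \<open>linear m\<close> linear_so3_so3])
  then show ?thesis using that by blast
qed

section \<open>The 4-form on matrices\<close>

text \<open>As a 2-form this is \<open>\<sigma>(\<theta>)\<^sup>T \<and> \<sigma>(\<theta>)\<close>, with values in the
  skew matrices. It is unchanged by \<open>X \<mapsto> P X\<close> and conjugated by \<open>Q\<close> under
  \<open>X \<mapsto> X Q\<^sup>T\<close> for orthogonal \<open>P\<close> and \<open>Q\<close>, which makes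
  the invariance of \<open>\<omega>\<close> visible.\<close>

definition skew_prod :: "real^3^3 \<Rightarrow> real^3^3 \<Rightarrow> real^3^3" where
  "skew_prod X Y = transpose X ** Y - transpose Y ** X"

text \<open>The wedge square of the 2-form \<open>skew_prod\<close>, contracted with the Frobenius inner product, is twice the
  sum of these three terms; the factor \<open>1/4\<close> is the one in the definition of
  \<open>\<omega>\<close>.\<close>

definition omega_mat :: "real^3^3 \<Rightarrow> real^3^3 \<Rightarrow> real^3^3 \<Rightarrow> real^3^3 \<Rightarrow> real" where
  "omega_mat X Y Z W = (skew_prod X Y \<bullet> skew_prod Z W - skew_prod X Z \<bullet> skew_prod Y W
     + skew_prod X W \<bullet> skew_prod Y Z) / 2"

lemma det_4:
  "det (A :: 'a::comm_ring_1^4^4) =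
    A$1$1 * (A$2$2 * (A$3$3 * A$4$4 - A$3$4 * A$4$3) - A$2$3 * (A$3$2 * A$4$4 - A$3$4 * A$4$2)
      + A$2$4 * (A$3$2 * A$4$3 - A$3$3 * A$4$2))
  - A$1$2 * (A$2$1 * (A$3$3 * A$4$4 - A$3$4 * A$4$3) - A$2$3 * (A$3$1 * A$4$4 - A$3$4 * A$4$1)
      + A$2$4 * (A$3$1 * A$4$3 - A$3$3 * A$4$1))
  + A$1$3 * (A$2$1 * (A$3$2 * A$4$4 - A$3$4 * A$4$2) - A$2$2 * (A$3$1 * A$4$4 - A$3$4 * A$4$1)
      + A$2$4 * (A$3$1 * A$4$2 - A$3$2 * A$4$1))
  - A$1$4 * (A$2$1 * (A$3$2 * A$4$3 - A$3$3 * A$4$2) - A$2$2 * (A$3$1 * A$4$3 - A$3$3 * A$4$1)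
      + A$2$3 * (A$3$1 * A$4$2 - A$3$2 * A$4$1))"
proof -
  have f1: "finite {2::4, 3, 4}" "1 \<notin> {2::4, 3, 4}" by auto
  have f2: "finite {3::4, 4}" "2 \<notin> {3::4, 4}" by auto
  have f3: "finite {4::4}" "3 \<notin> {4::4}" by auto
  show ?thesis
    unfolding det_def UNIV_4
    unfolding sum_over_permutations_insert[OF f1]
    unfolding sum_over_permutations_insert[OF f2]
    unfolding sum_over_permutations_insert[OF f3]
    unfolding permutes_sing
    by (simp add: sign_swap_id permutation_swap_id sign_compose permutation_compose sign_id swap_id_eq)
       (simp add: algebra_simps)
qed

lemma wedge4_expand:
  "wedge4 a b c d x y z w =
    (a x * b y - a y * b x) * (c z * d w - c w * d z)
  - (a x * b z - a z * b x) * (c y * d w - c w * d y)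
  + (a x * b w - a w * b x) * (c y * d z - c z * d y)
  + (a y * b z - a z * b y) * (c x * d w - c w * d x)
  - (a y * b w - a w * b y) * (c x * d z - c z * d x)
  + (a z * b w - a w * b z) * (c x * d y - c y * d x)"
  unfolding wedge4_def det_4 vector_4 by (simp add: algebra_simps)

text \<open>The sum over the rows of the \<open>2 \<times> 2\<close> minors in the columns \<open>p\<close> and
  \<open>q\<close>, which is an entry of \<open>skew_prod\<close>.\<close>

definition minor_sum :: "3 \<Rightarrow> 3 \<Rightarrow> real^3^3 \<Rightarrow> real^3^3 \<Rightarrow> real" where
 "minor_sum p q X Y = (\<Sum>i\<in>UNIV. X $ i $ p * Y $ i $ q - X $ i $ q * Y $ i $ p)"

lemma skew_prod_nth: "skew_prod X Y $ p $ q = minor_sum p q X Y"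
  by (simp add: skew_prod_def minor_sum_def matrix_matrix_mult_def transpose_def sum_subtractf mult.commute)

lemma inner_skew_prod: "skew_prod X Y \<bullet> skew_prod Z W =
  2 * (minor_sum 1 2 X Y * minor_sum 1 2 Z W + minor_sum 1 3 X Y * minor_sum 1 3 Z W
    + minor_sum 2 3 X Y * minor_sum 2 3 Z W)"
proof -
  have 2: "minor_sum q p X Y = - minor_sum p q X Y" for p q X Y
    by (simp add: minor_sum_def sum_subtractf mult.commute)
  have 3: "minor_sum p p X Y = 0" for p X Y using 2[of p p X Y] by simp
  show ?thesis
    by (simp add: inner_vec_def sum_3 skew_prod_nth 3 2[of 2 1] 2[of 3 1] 2[of 3 2] del: One_nat_def)
qed

text \<open>The column pair \<open>p, q\<close> accounts for the three terms of \<open>\<omega>\<close> indexed by pairs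
  of rows.\<close>

lemma minor_sum_wedge:
  "minor_sum p q X Y * minor_sum p q Z W - minor_sum p q X Z * minor_sum p q Y W
     + minor_sum p q X W * minor_sum p q Y Z
   = wedge4 (\<lambda>X. X$1$p) (\<lambda>X. X$1$q) (\<lambda>X. X$2$p) (\<lambda>X. X$2$q) X Y Z W
   + wedge4 (\<lambda>X. X$1$p) (\<lambda>X. X$1$q) (\<lambda>X. X$3$p) (\<lambda>X. X$3$q) X Y Z W
   + wedge4 (\<lambda>X. X$2$p) (\<lambda>X. X$2$q) (\<lambda>X. X$3$p) (\<lambda>X. X$3$q) X Y Z W"
proof -
  define m where "m i X Y = X $ i $ p * Y $ i $ q - Y $ i $ p * X $ i $ q" for i and X Y :: "real^3^3"
  \<comment> \<open>Pluecker relation: the contributions of a single row cancel, and those of two distinct rows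
    make up the wedge products.\<close>
  have pl: "m i X Y * m i Z W - m i X Z * m i Y W + m i X W * m i Y Z = 0" for i
    by (simp add: m_def algebra_simps)
  have b: "minor_sum p q X Y = m 1 X Y + m 2 X Y + m 3 X Y" for X Y
    by (simp add: minor_sum_def m_def sum_3 mult.commute)
  show ?thesis
    unfolding wedge4_expand m_def[symmetric] b using pl[of 1] pl[of 2] pl[of 3]
    by (simp add: algebra_simps)
qed

lemma omega_eq_omega_mat: "omega x y z w = omega_mat (sigma9 x) (sigma9 y) (sigma9 z) (sigma9 w)"
proof -
  have "omega_mat X Y Z W = (minor_sum 1 2 X Y * minor_sum 1 2 Z W
        - minor_sum 1 2 X Z * minor_sum 1 2 Y W
        + minor_sum 1 2 X W * minor_sum 1 2 Y Z)
    + (minor_sum 1 3 X Y * minor_sum 1 3 Z W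
        - minor_sum 1 3 X Z * minor_sum 1 3 Y W
        + minor_sum 1 3 X W * minor_sum 1 3 Y Z)
    + (minor_sum 2 3 X Y * minor_sum 2 3 Z W
        - minor_sum 2 3 X Z * minor_sum 2 3 Y W
        + minor_sum 2 3 X W * minor_sum 2 3 Y Z)" for X Y Z W
    unfolding omega_mat_def inner_skew_prod by simp
  moreover have "wedge4 (\<lambda>X. X$i$p) (\<lambda>X. X$i$q) (\<lambda>X. X$j$p) (\<lambda>X. X$j$q)
      (sigma9 x) (sigma9 y) (sigma9 z) (sigma9 w)
    = wedge4 (\<lambda>x. sigma9 x$i$p) (\<lambda>x. sigma9 x$i$q)
        (\<lambda>x. sigma9 x$j$p) (\<lambda>x. sigma9 x$j$q) x y z w" for i j p q
    by (simp add: wedge4_def)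
  ultimately show ?thesis
    unfolding omega_eq minor_sum_wedge theta_def by (simp del: One_nat_def)
qed

lemma minor_sum_munit_first:
  "minor_sum p q (munit i a) Y = (if p = a then Y $ i $ q else 0) - (if q = a then Y $ i $ p else 0)"
  by (cases "p = a"; cases "q = a";
      simp add: minor_sum_def sum_subtractf sum_negf if_distrib[of "\<lambda>x. x * _"] cong: if_cong)

lemma minor_sum_swap: "minor_sum p q Y X = - minor_sum p q X Y" "minor_sum q p X Y = - minor_sum p q X Y"
  by (simp_all add: minor_sum_def sum_subtractf mult.commute)

lemma minor_sum_munit_second:
  "minor_sum p q Y (munit i a) = (if q = a then Y $ i $ p else 0) - (if p = a then Y $ i $ q else 0)"
  by (simp add: minor_sum_swap(1)[of p q Y "munit i a"] minor_sum_munit_first)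

lemma omega_mat_minor_sum:
  "omega_mat X Y Z W = (\<Sum>p\<in>UNIV. \<Sum>q\<in>UNIV. minor_sum p q X Y * minor_sum p q Z W
    - minor_sum p q X Z * minor_sum p q Y W + minor_sum p q X W * minor_sum p q Y Z) / 2"
  by (simp add: omega_mat_def inner_vec_def skew_prod_nth sum.distrib sum_subtractf)

lemma omega_mat_swap: "omega_mat Y X Z W = - omega_mat X Y Z W"
proof -
  have *: "skew_prod Y X = - skew_prod X Y" for X Y by (simp add: skew_prod_def)
  show ?thesis unfolding omega_mat_def *[of Y X] by (simp add: inner_commute diff_divide_distrib add_divide_distrib)
qed

text \<open>With one argument a matrix unit, the sum over pairs of columns collapses to a single sum, which keeps the
  evaluation on matrix units small.\<close>

lemma omega_mat_munit_first:
  "omega_mat (munit i a) Y Z W =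
   (\<Sum>q\<in>UNIV. Y $ i $ q * minor_sum a q Z W - Z $ i $ q * minor_sum a q Y W + W $ i $ q * minor_sum a q Y Z)"
proof -
  have "(\<Sum>p\<in>UNIV. \<Sum>q\<in>UNIV. minor_sum p q (munit i a) Y * minor_sum p q Z W)
    = 2 * (\<Sum>q\<in>UNIV. Y $ i $ q * minor_sum a q Z W)"
   (is "?L = _") for Y Z W
  proof -
    have "?L = (\<Sum>q\<in>UNIV. Y $ i $ q * minor_sum a q Z W) - (\<Sum>p\<in>UNIV. Y $ i $ p * minor_sum p a Z W)"
      unfolding minor_sum_munit_first left_diff_distrib sum_subtractf
      by (subst sum.swap) (simp add: if_distrib if_distribR cong: if_cong)
    also have "\<dots> = 2 * (\<Sum>q\<in>UNIV. Y $ i $ q * minor_sum a q Z W)"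
      by (simp add: minor_sum_swap(2)[of a] sum_negf)
    finally show ?thesis .
  qed
  then show ?thesis
    unfolding omega_mat_minor_sum by (simp add: sum.distrib sum_subtractf)
qed

lemma omega_mat_munit_second:
  "omega_mat Y (munit i a) Z W =
   - (\<Sum>q\<in>UNIV. Y $ i $ q * minor_sum a q Z W - Z $ i $ q * minor_sum a q Y W + W $ i $ q * minor_sum a q Y Z)"
  by (simp only: omega_mat_swap[of Y] omega_mat_munit_first)

lemmas omega_mat_munit_simps =
  omega_mat_munit_first omega_mat_munit_second minor_sum_munit_first minor_sum_munit_second

section \<open>The Lie algebra annihilating the 4-form\<close>

text \<open>The coefficients of \<open>\<omega>\<close> are the rectangles in the matrix of indices, so the condition on a
  quadruple of matrix units has at most four terms. Quadruples that miss being a rectangle by one corner give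
  the relations between coefficients off the diagonal, and the rectangles give those between diagonal ones.\<close>

lemma omega_mat_annihilator:
  fixes m :: "real^3^3 \<Rightarrow> real^3^3"
  assumes "linear m"
    and ann: "\<And>X Y Z W. omega_mat (m X) Y Z W + omega_mat X (m Y) Z W
      + omega_mat X Y (m Z) W + omega_mat X Y Z (m W) = 0"
  obtains a b where "m = so3_so3 a b"
proof (rule so3_so3_of_entries[OF \<open>linear m\<close>])
  fix i j q r :: 3
  assume ij: "i \<noteq> j" and qr: "q \<noteq> r"
  obtain k where k: "i \<noteq> k" "j \<noteq> k" using third_index[OF ij] by metis
  obtain p where p: "q \<noteq> p" "r \<noteq> p" using third_index[OF qr] by metis
  note s = sum_distinct_3[of p q r]
  \<comment> \<open>Each quadruple below is three corners of a rectangle of entries, together with a fourth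
    entry that is not the missing corner.\<close>
  show "m (munit j r) $ i $ q = 0"
    using ann[of "munit k p" "munit k q" "munit i p" "munit j r"] ij qr k p
    unfolding omega_mat_munit_simps by (simp add: s)
  show "m (munit j r) $ j $ q = - m (munit i q) $ i $ r"
    using ann[of "munit i p" "munit i q" "munit j p" "munit j r"] ij qr k p
    unfolding omega_mat_munit_simps by (simp add: s)
  show "m (munit j q) $ i $ q = - m (munit i r) $ j $ r"
    using ann[of "munit k r" "munit k q" "munit i r" "munit j q"] ij qr k p
    unfolding omega_mat_munit_simps by (simp add: s)
next
  fix i q :: 3
  \<comment> \<open>The four corners of a rectangle give a relation between diagonal coefficients; three rows and
    three columns are enough to make all of them vanish.\<close>
  define d where "d j p = m (munit j p) $ j $ p" for j p
  have rect: "d i p + d i q + d j p + d j q = 0" if ij: "i \<noteq> j" and pq: "p \<noteq> q" for i j p q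
  proof -
    obtain r where r: "p \<noteq> r" "q \<noteq> r" using third_index[OF pq] by metis
    show ?thesis
    using ann[of "munit i p" "munit i q" "munit j p" "munit j q"] ij pq r
    unfolding omega_mat_munit_simps
      by (simp add: sum_distinct_3[of p q r] d_def)
  qed
  have col: "d i p + d j p = 0" if ij: "i \<noteq> j" for i j p
  proof -
    obtain q where q: "p \<noteq> q" by (rule that[of "p + 1"]) simp
    obtain r where r: "p \<noteq> r" "q \<noteq> r" using third_index[OF q] by metis
    show ?thesis using rect[OF ij q] rect[OF ij r(1)] rect[OF ij r(2)] by simp
  qed
  obtain j where j: "i \<noteq> j" by (rule that[of "i + 1"]) simp
  obtain k where k: "i \<noteq> k" "j \<noteq> k" using third_index[OF j] by metis
  show "m (munit i q) $ i $ q = 0"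
    using col[OF j, of q] col[OF k(1), of q] col[OF k(2), of q] by (simp add: d_def)
qed (use that in blast)

text \<open>A left multiplication by a skew matrix does not change \<open>skew_prod\<close> to first order. A right
  multiplication changes it by a commutator with a skew matrix, which is skew for the Frobenius inner product.\<close>

lemma so3_so3_annihilates_omega_mat:
  "omega_mat (so3_so3 a b X) Y Z W + omega_mat X (so3_so3 a b Y) Z W + omega_mat X Y (so3_so3 a b Z) W
     + omega_mat X Y Z (so3_so3 a b W) = 0"
proof -
  let ?m = "so3_so3 a b"
  have d: "skew_prod (?m X) Y + skew_prod X (?m Y) = skew_prod X Y ** hat b - hat b ** skew_prod X Y" for X Y
    by (simp add: so3_so3_def skew_prod_def transpose_simps transpose_hat matrix_mult_simps
        matrix_mul_assoc algebra_simps)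
  have sk: "(C ** hat b - hat b ** C) \<bullet> D + C \<bullet> (D ** hat b - hat b ** D) = 0" for C D
    by (simp add: inner_diff_left inner_diff_right inner_matrix_mult(1)[of "hat b" C]
       inner_matrix_mult(2)[of C "hat b"] transpose_hat matrix_mult_simps)
  let ?d = "\<lambda>X Y Z W. (skew_prod (?m X) Y + skew_prod X (?m Y)) \<bullet> skew_prod Z W
    + skew_prod X Y \<bullet> (skew_prod (?m Z) W + skew_prod Z (?m W))"
  have "omega_mat (?m X) Y Z W + omega_mat X (?m Y) Z W + omega_mat X Y (?m Z) W + omega_mat X Y Z (?m W)
    = (?d X Y Z W - ?d X Z Y W + ?d X W Y Z) / 2"
    by (simp add: omega_mat_def inner_add_left inner_add_right add_divide_distrib diff_divide_distrib)
  then show ?thesis unfolding d sk by simp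
qed

section \<open>The Lie algebra annihilating the metric and the cubic form\<close>

text \<open>The tensor \<open>\<Upsilon>\<close> transported to matrices.\<close>

definition det_polar :: "real^3^3 \<Rightarrow> real^3^3 \<Rightarrow> real^3^3 \<Rightarrow> real" where
  "det_polar X Y Z = det (X + Y + Z) - det (X + Y) - det (X + Z) - det (Y + Z)
     + det X + det Y + det Z"

lemma Upsilon_eq_det_polar: "Upsilon u v w = det_polar (sigma9 u) (sigma9 v) (sigma9 w)"
  by (simp add: Upsilon_def det_polar_def linear_add[OF linear_sigma])

lemma det_polar_diag: "det_polar X X X = 6 * det X"
  using Upsilon_diag[of "inv sigma9 X"] by (simp add: Upsilon_eq_det_polar)

lemma det_polar_commute: "det_polar X Y Z = det_polar Y X Z" "det_polar X Y Z = det_polar X Z Y"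
  by (simp_all add: det_polar_def add_ac)

lemma det_polar_linear: "det_polar (X + X') Y Z = det_polar X Y Z + det_polar X' Y Z"
  "det_polar (c *\<^sub>R X) Y Z = c * det_polar X Y Z"
  using linear_add[OF linear_Upsilon, of "inv sigma9 X" "inv sigma9 X'" "inv sigma9 Y" "inv sigma9 Z"]
  linear_cmul[OF linear_Upsilon, of c "inv sigma9 X" "inv sigma9 Y" "inv sigma9 Z"]
  by (simp_all add: Upsilon_eq_det_polar linear_add[OF linear_sigma] linear_cmul[OF linear_sigma])

lemma linear_det_polar: "linear (\<lambda>X. det_polar X Y Z)"
  by (rule linearI) (simp_all add: det_polar_linear)

text \<open>The determinant expanded along an arbitrary order of the rows and columns; \<open>s\<close> is the product of
  the signs of the two orders.\<close>

lemma det_3_distinct: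
  fixes i j k p q r :: 3
  assumes "i \<noteq> j" "j \<noteq> k" "i \<noteq> k" "p \<noteq> q" "q \<noteq> r" "p \<noteq> r"
  obtains s :: real where "s \<noteq> 0" "\<And>X. det X = s *
    (X$i$p * X$j$q * X$k$r + X$i$q * X$j$r * X$k$p + X$i$r * X$j$p * X$k$q
     - X$i$p * X$j$r * X$k$q - X$i$q * X$j$p * X$k$r - X$i$r * X$j$q * X$k$p)"
proof -
  let ?d = "\<lambda>X::real^3^3. X$i$p * X$j$q * X$k$r + X$i$q * X$j$r * X$k$p + X$i$r * X$j$p * X$k$q
     - X$i$p * X$j$r * X$k$q - X$i$q * X$j$p * X$k$r - X$i$r * X$j$q * X$k$p"
  have "(\<forall>X::real^3^3. det X = ?d X) \<or> (\<forall>X::real^3^3. det X = - ?d X)"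
  proof -
    have "i = 1 \<and> j = 2 \<and> k = 3 \<or> i = 1 \<and> j = 3 \<and> k = 2 \<or> i = 2 \<and> j = 1 \<and> k = 3
      \<or> i = 2 \<and> j = 3 \<and> k = 1 \<or> i = 3 \<and> j = 1 \<and> k = 2 \<or> i = 3 \<and> j = 2 \<and> k = 1"
      using assms(1-3) exhaust_3[of i] exhaust_3[of j] exhaust_3[of k] by auto
    moreover have "p = 1 \<and> q = 2 \<and> r = 3 \<or> p = 1 \<and> q = 3 \<and> r = 2 \<or> p = 2 \<and> q = 1 \<and> r = 3
      \<or> p = 2 \<and> q = 3 \<and> r = 1 \<or> p = 3 \<and> q = 1 \<and> r = 2 \<or> p = 3 \<and> q = 2 \<and> r = 1"
      using assms(4-6) exhaust_3[of p] exhaust_3[of q] exhaust_3[of r] by auto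
    ultimately show ?thesis
      by (elim disjE; elim conjE; simp add: det_3 algebra_simps)
  qed
  then show ?thesis using that[of 1] that[of "-1"] by auto
qed

text \<open>The derivation condition on matrix units involves single cofactors only. Two equal arguments force the
  coefficients between entries in different rows and columns to vanish. Two arguments in one column, or in one
  row, compare the coefficients of different rows, or columns. Skewness for the metric does the rest.\<close>

lemma metric_det_annihilator:
  fixes m :: "real^3^3 \<Rightarrow> real^3^3"
  assumes "linear m"
    and skew: "\<And>X Y. m X \<bullet> Y + X \<bullet> m Y = 0"
    and ann: "\<And>X Y Z. det_polar (m X) Y Z + det_polar X (m Y) Z + det_polar X Y (m Z) = 0"
  obtains a b where "m = so3_so3 a b"
proof (rule so3_so3_of_entries[OF \<open>linear m\<close>])
  have mu: "munit i p \<bullet> X = X $ i $ p" for i p X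
    using exhaust_3[of i] exhaust_3[of p] by (auto simp: inner_vec_def sum_3)
  then have sk: "m (munit i p) $ j $ q = - m (munit j q) $ i $ p" for i p j q
    using skew[of "munit i p" "munit j q"] by (simp add: mu inner_commute[of "m (munit i p)"])
  then show "m (munit i q) $ i $ q = 0" for i q by (metis equal_neg_zero)
  fix i j q r :: 3
  assume ij: "i \<noteq> j" and qr: "q \<noteq> r"
  obtain k where k: "i \<noteq> k" "j \<noteq> k" using third_index[OF ij] by metis
  obtain p where p: "q \<noteq> p" "r \<noteq> p" using third_index[OF qr] by metis
  have ne: "p \<noteq> q" "p \<noteq> r" using p by auto
  obtain s :: real where s: "s \<noteq> 0" "\<And>X. det X = s *
    (X$i$p * X$j$q * X$k$r + X$i$q * X$j$r * X$k$p + X$i$r * X$j$p * X$k$q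
     - X$i$p * X$j$r * X$k$q - X$i$q * X$j$p * X$k$r - X$i$r * X$j$q * X$k$p)"
    by (rule det_3_distinct[OF ij k(2) k(1) ne(1) qr ne(2)], rule that)
  have eq: "det_polar X Y Z = c * X $ a $ b"
    if *: "\<forall>l\<in>{i, j, k}. \<forall>t\<in>{p, q, r}. det_polar (munit l t) Y Z = c * munit l t $ a $ b" for X Y Z c a b
  proof (rule linear_eq_on_munit[OF linear_det_polar])
    show "linear (\<lambda>X. c * X $ a $ b)" by (rule linearI) (simp_all add: algebra_simps)
    fix l t
    have "l \<in> {i, j, k}" "t \<in> {p, q, r}"
      using exhaust_3_distinct[OF ij k(2,1), of l] exhaust_3_distinct[OF ne(1) qr ne(2), of t] by auto
    then show "det_polar (munit l t) Y Z = c * munit l t $ a $ b" using * by blast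
  qed
  \<comment> \<open>The cofactors that occur below, up to the common sign \<open>s\<close> of the two index permutations.\<close>
  have c: "det_polar X (munit j r) (munit k p) = s * X $ i $ q"
    "det_polar X (munit i r) (munit k p) = - s * X $ j $ q"
    "det_polar X (munit j q) (munit k p) = - s * X $ i $ r"
    "det_polar X (munit j r) (munit j r) = 0 * X $ i $ q"
    "det_polar X (munit j r) (munit i r) = 0 * X $ i $ q"
    "det_polar X (munit j q) (munit j r) = 0 * X $ i $ q" for X
    by - (rule eq, use ij qr k p in \<open>simp add: det_polar_def s(2)\<close>)+
  have rot: "det_polar X Y (m Z) = det_polar (m Z) X Y" for X Y Z
    by (metis det_polar_commute)
  show "m (munit j r) $ i $ q = 0"
    using ann[of "munit j r" "munit j r" "munit k p"] s(1)
    unfolding det_polar_commute(1)[of "munit _ _" "m _"] rot c by simp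
  have "m (munit j r) $ j $ q = m (munit i r) $ i $ q"
    using ann[of "munit j r" "munit i r" "munit k p"] s(1)
    unfolding det_polar_commute(1)[of "munit _ _" "m _"] rot c by simp
  then show "m (munit j r) $ j $ q = - m (munit i q) $ i $ r"
    by (metis sk)
  have "m (munit j q) $ i $ q = m (munit j r) $ i $ r"
    using ann[of "munit j q" "munit j r" "munit k p"] s(1)
    unfolding det_polar_commute(1)[of "munit _ _" "m _"] rot c by simp
  then show "m (munit j q) $ i $ q = - m (munit i r) $ j $ r"
    by (metis sk)
qed (use that in blast)

lemma det_polar_mult: "det_polar (M ** X) (M ** Y) (M ** Z) = det M * det_polar X Y Z"
  by (simp add: det_polar_def matrix_add_ldistrib[symmetric] det_mul algebra_simps)

lemma det_polar_transpose: "det_polar (transpose X) (transpose Y) (transpose Z) = det_polar X Y Z"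
  unfolding det_polar_def linear_add[OF linear_transpose, symmetric] det_transpose ..

text \<open>The first-order term in \<open>t\<close> of \<open>det (1 + t a) = 1 + O(t\<^sup>2)\<close>, extracted
  algebraically by comparing values of a cubic polynomial.\<close>

lemma hat_annihilates_det_polar:
  "det_polar (hat a ** X) Y Z + det_polar X (hat a ** Y) Z + det_polar X Y (hat a ** Z) = 0"
proof -
  let ?m = "\<lambda>X. hat a ** X"
  define D2 where "D2 = det_polar (?m X) (?m Y) Z + det_polar (?m X) Y (?m Z) + det_polar X (?m Y) (?m Z)"
  define D3 where "D3 = det_polar (?m X) (?m Y) (?m Z)"
  let ?D1 = "det_polar (?m X) Y Z + det_polar X (?m Y) Z + det_polar X Y (?m Z)"
  have add2: "det_polar X (Y + Y') Z = det_polar X Y Z + det_polar X Y' Z"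
    "det_polar X (c *\<^sub>R Y) Z = c * det_polar X Y Z" for X Y Y' Z c
    using det_polar_linear det_polar_commute(1) by metis+
  have add3: "det_polar X Y (Z + Z') = det_polar X Y Z + det_polar X Y Z'"
    "det_polar X Y (c *\<^sub>R Z) = c * det_polar X Y Z" for X Y Z Z' c
    using add2 det_polar_commute(2) by metis+
  \<comment> \<open>\<open>det (1 + t a) = 1 + t\<^sup>2 |a|\<^sup>2\<close> has no term of degree one in \<open>t\<close>.\<close>
  have "(1 + t\<^sup>2 * (a \<bullet> a)) * det_polar X Y Z = det_polar X Y Z + t * ?D1 + t\<^sup>2 * D2 + t^3 * D3" for t
  proof -
    have "det (mat 1 + t *\<^sub>R hat a) = 1 + t\<^sup>2 * (a \<bullet> a)"
      by (simp add: det_3 hat_def mat_def inner_vec_def sum_3 power2_eq_square algebra_simps)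
    then have "(1 + t\<^sup>2 * (a \<bullet> a)) * det_polar X Y Z =
      det_polar (X + t *\<^sub>R ?m X) (Y + t *\<^sub>R ?m Y) (Z + t *\<^sub>R ?m Z)"
      using det_polar_mult[of "mat 1 + t *\<^sub>R hat a" X Y Z] by (simp add: matrix_mult_simps)
    also have "\<dots> = det_polar X Y Z + t * ?D1 + t\<^sup>2 * D2 + t^3 * D3"
      by (simp add: det_polar_linear add2 add3 D2_def D3_def algebra_simps power2_eq_square power3_eq_cube)
    finally show ?thesis .
  qed
  \<comment> \<open>Odd parts at \<open>t = 1\<close> and \<open>t = 2\<close>: \<open>?D1 + D3 = 0\<close> and \<open>2 ?D1 + 8 D3 = 0\<close>.\<close>
  from this[of 1] this[of "-1"] this[of 2] this[of "-2"] show ?thesis by simp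
qed

lemma so3_so3_annihilates_det_polar:
  "det_polar (so3_so3 a b X) Y Z + det_polar X (so3_so3 a b Y) Z + det_polar X Y (so3_so3 a b Z) = 0"
proof -
  have "det_polar (X ** hat b) Y Z + det_polar X (Y ** hat b) Z + det_polar X Y (Z ** hat b) = 0"
    using hat_annihilates_det_polar[of "-b" "transpose X" "transpose Y" "transpose Z"]
    by (subst (1 2 3) det_polar_transpose[symmetric])
       (simp add: transpose_simps transpose_hat linear_neg[OF linear_hat])
  moreover note hat_annihilates_det_polar[of a X Y Z]
  moreover have "det_polar X (Y + Y') Z = det_polar X Y Z + det_polar X Y' Z"
    "det_polar X Y (Z + Z') = det_polar X Y Z + det_polar X Y Z'" for X Y Y' Z Z'
    using det_polar_linear(1) det_polar_commute by metis+
  ultimately show ?thesis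
    unfolding so3_so3_def by (simp add: det_polar_linear(1))
qed

lemma so3_so3_annihilates_inner: "so3_so3 a b X \<bullet> Y + X \<bullet> so3_so3 a b Y = 0"
  by (simp add: so3_so3_def inner_add_left inner_add_right inner_matrix_mult(1)[of "hat a"]
     inner_matrix_mult(2)[of _ "hat b"] transpose_hat matrix_mult_simps)

section \<open>The normaliser of the Lie algebra\<close>

text \<open>Exchanging the two indices of the left factors changes the sign of the first term and not of the second, so
  both terms vanish separately.\<close>

lemma skew_symmetric_separation:
  assumes eq: "\<And>X. hat a ** X ** Q + P ** X ** hat b = 0"
    and P: "transpose P = P"
  shows "a = 0 \<or> Q = 0"
proof (rule ccontr)
  assume "\<not> ?thesis"
  then obtain l j where lj: "Q $ l $ j \<noteq> 0" and a: "a \<noteq> 0" by (auto simp: vec_eq_iff)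
  have e: "hat a $ i $ k * Q $ l $ j + P $ i $ k * hat b $ l $ j = 0" for i k
    using arg_cong[OF eq[of "munit k l"], of "\<lambda>M. M $ i $ j"] by (simp add: sandwich_munit)
  have "hat a $ i $ k = 0" for i k
  proof -
    have 1: "hat a $ k $ i = - hat a $ i $ k"
      using arg_cong[OF transpose_hat[of a], of "\<lambda>M. M $ i $ k"] by (simp add: transpose_def)
    have 2: "P $ k $ i = P $ i $ k"
      using arg_cong[OF P, of "\<lambda>M. M $ i $ k"] by (simp add: transpose_def)
    have "hat a $ i $ k * Q $ l $ j = 0" using e[of i k] e[of k i] unfolding 1 2 by linarith
    then show ?thesis using lj by simp
  qed
  then have "hat a = 0" by (simp add: vec_eq_iff)
  then show False using a by (simp add: hat_eq_0_iff)
qed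

text \<open>Left multiplication by \<open>hat a\<close> and right multiplication by \<open>hat b\<close> have
  eigenvalues \<open>0, \<plusminus>i|a|\<close> and \<open>0, \<plusminus>i|b|\<close>; if both are
  nonzero, the sum has too many different eigenvalues for a polynomial identity
  \<open>T\<^sup>3 = - n T\<close>. The proof replaces eigenvalues by a comparison of coefficients.\<close>

lemma so3_so3_cube:
  assumes cube: "\<And>X. so3_so3 a b (so3_so3 a b (so3_so3 a b X)) = - n *\<^sub>R so3_so3 a b X"
  shows "a = 0 \<or> b = 0"
proof -
  \<comment> \<open>Left and right multiplication commute. Expanding the cube and using the cubic identity for
    \<open>hat a\<close> and \<open>hat b\<close> leaves the terms \<open>aX\<close>, \<open>Xb\<close>, \<open>aaXb\<close> and \<open>aXbb\<close>, grouped here by which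
    factor is skew.\<close>
  let ?Q = "(n - a \<bullet> a) *\<^sub>R mat 1 + 3 *\<^sub>R (hat b ** hat b)"
  let ?P = "(n - b \<bullet> b) *\<^sub>R mat 1 + 3 *\<^sub>R (hat a ** hat a)"
  have "hat a ** X ** ?Q + ?P ** X ** hat b = 0" for X
  proof -
    have c: "hat c ** hat c ** hat c ** Y = - (c \<bullet> c) *\<^sub>R (hat c ** Y)"
        "Y ** hat c ** hat c ** hat c = - (c \<bullet> c) *\<^sub>R (Y ** hat c)" for c Y
      using arg_cong[OF hat_cube[of c], of "\<lambda>M. M ** Y"] arg_cong[OF hat_cube[of c], of "\<lambda>M. Y ** M"]
      by (simp_all add: matrix_mul_assoc matrix_mult_simps)
    have "hat a ** X ** ?Q + ?P ** X ** hat b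
       = so3_so3 a b (so3_so3 a b (so3_so3 a b X)) + n *\<^sub>R so3_so3 a b X"
      unfolding so3_so3_def matrix_mult_simps matrix_mul_assoc c vec_eq_iff vector_add_component
        vector_scaleR_component matrix_mul_lid matrix_mul_rid
      by (simp add: algebra_simps)
    then show ?thesis by (simp add: cube)
  qed
  moreover have "transpose ?P = ?P"
    by (simp add: transpose_simps transpose_hat matrix_mult_simps)
  ultimately have "a = 0 \<or> ?Q = 0" by (rule skew_symmetric_separation)
  moreover have "b = 0" if Q: "?Q = 0"
  proof (rule ccontr)
    assume b: "b \<noteq> 0"
    \<comment> \<open>If \<open>?Q = 0\<close> then \<open>hat b\<close> squares to a multiple of the identity; multiplying by the singular
      \<open>hat b\<close> and taking the trace give two incompatible values for that multiple.\<close>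
    have "(n - a \<bullet> a - 3 * (b \<bullet> b)) *\<^sub>R hat b = hat b ** ?Q"
      by (simp add: matrix_mult_simps hat_cube algebra_simps)
    then have 1: "n - a \<bullet> a = 3 * (b \<bullet> b)"
      using Q b by (simp add: matrix_mult_simps hat_eq_0_iff)
    have "?Q $ 1 $ 1 + ?Q $ 2 $ 2 + ?Q $ 3 $ 3 = 0" using Q by simp
    then have "3 * (n - a \<bullet> a) + 3 * (- 2 * (b \<bullet> b)) = 0"
      unfolding trace_hat_square[symmetric] by (simp add: mat_def algebra_simps)
    then have "b \<bullet> b = 0" using 1 by simp
    then show False using b by simp
  qed
  ultimately show ?thesis by blast
qed

lemma hat_linear_imp_matrix_linear:
  assumes "linear F" and hat: "\<And>a X. F (hat a ** X) = hat a ** F X"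
  shows "F (M ** X) = M ** F X"
proof -
  have off: "F (munit i j ** X) = munit i j ** F X" if "i \<noteq> j" for i j X
    unfolding munit_eq_hat[OF that] by (simp add: hat flip: matrix_mul_assoc)
  have "F (munit i j ** X) = munit i j ** F X" for i j
  proof (cases "i = j")
    case True
    obtain k where k: "i \<noteq> k" by (rule that[of "i + 1"]) simp
    then show ?thesis unfolding True munit_mult[of j k j, symmetric]
      using True by (simp add: off flip: matrix_mul_assoc)
  qed (simp add: off)
  note munit = this
  have "linear (\<lambda>M. F (M ** X))"
    by (rule linearI) (simp_all add: matrix_mult_simps linear_add[OF \<open>linear F\<close>] linear_cmul[OF \<open>linear F\<close>])
  moreover have "linear (\<lambda>M. M ** F X)"
    by (rule linearI) (simp_all add: matrix_mult_simps)
  ultimately show ?thesis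
    using linear_eq_on_munit[of "\<lambda>M. F (M ** X)" "\<lambda>M. M ** F X" M] munit by blast
qed

text \<open>The map \<open>\<phi>\<close> induced on skew matrices preserves the Lie bracket, which is the cross product,
  and the length, so it is a rotation.\<close>

lemma left_normalizer_rotation:
  fixes F :: "real^3^3 \<Rightarrow> real^3^3"
  assumes "linear F" "bij F" and left: "\<And>a. \<exists>a'. \<forall>X. F (hat a ** X) = hat a' ** F X"
  obtains P where "P \<in> SO3" "\<And>a X. F (hat a ** X) = hat (P *v a) ** F X"
proof -
  obtain \<phi> where \<phi>: "F (hat a ** X) = hat (\<phi> a) ** F X" for a X using left by metis
  obtain J where J: "F J = mat 1" using \<open>bij F\<close> by (metis bij_pointE)
  have FJ: "F (hat a ** J) = hat (\<phi> a)" for a by (simp add: \<phi> J)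
  note F = linear_add[OF \<open>linear F\<close>] linear_diff[OF \<open>linear F\<close>] linear_cmul[OF \<open>linear F\<close>]
  have "linear \<phi>"
  proof (rule linearI)
    fix x y c
    have "hat (\<phi> (x + y)) = hat (\<phi> x + \<phi> y)"
      by (simp add: linear_add[OF linear_hat] matrix_mult_simps F flip: FJ)
    then show "\<phi> (x + y) = \<phi> x + \<phi> y" by simp
    have "hat (\<phi> (c *\<^sub>R x)) = hat (c *\<^sub>R \<phi> x)"
      by (simp add: linear_cmul[OF linear_hat] matrix_mult_simps F flip: FJ)
    then show "\<phi> (c *\<^sub>R x) = c *\<^sub>R \<phi> x" by simp
  qed
  have cross: "\<phi> (cross3 x y) = cross3 (\<phi> x) (\<phi> y)" for x y
  proof -
    have "hat (\<phi> (cross3 x y)) = F (hat x ** (hat y ** J)) - F (hat y ** (hat x ** J))"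
      unfolding FJ[symmetric] hat_cross3 by (simp add: matrix_mult_simps F matrix_mul_assoc)
    also have "\<dots> = hat (cross3 (\<phi> x) (\<phi> y))" by (simp add: \<phi> J hat_cross3)
    finally show ?thesis by simp
  qed
  have inj: "x = 0" if "\<phi> x = 0" for x
  proof -
    have "F (hat x ** mat 1) = F 0" using \<phi>[of x "mat 1"] that
      by (simp only: hat_0 matrix_mult_simps linear_0[OF \<open>linear F\<close>])
    then have "hat x = 0" using \<open>bij F\<close> by (simp add: bij_is_inj inj_eq)
    then show ?thesis by (simp add: hat_eq_0_iff)
  qed
  \<comment> \<open>The cubic identity \<open>a\<^sup>3 = - |a|\<^sup>2 a\<close> recovers the length of \<open>a\<close> from the algebra.\<close>
  have "\<phi> x \<bullet> \<phi> x = x \<bullet> x" for x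
  proof (cases "\<phi> x = 0")
    case True
    then show ?thesis using inj by auto
  next
    case False
    have "- (x \<bullet> x) *\<^sub>R hat (\<phi> x) = F (- (x \<bullet> x) *\<^sub>R (hat x ** J))" by (simp only: F FJ)
    also have "- (x \<bullet> x) *\<^sub>R (hat x ** J) = hat x ** (hat x ** (hat x ** J))"
      using arg_cong[OF hat_cube[of x], of "\<lambda>M. M ** J"] by (simp add: matrix_mul_assoc matrix_mult_simps)
    also have "F \<dots> = - (\<phi> x \<bullet> \<phi> x) *\<^sub>R hat (\<phi> x)" by (simp add: \<phi> J hat_cube)
    finally show ?thesis using False by (simp add: hat_eq_0_iff)
  qed
  then have orth: "orthogonal_transformation \<phi>"
    using \<open>linear \<phi>\<close> by (simp add: orthogonal_transformation norm_eq_sqrt_inner)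
  \<comment> \<open>An isometry respects the cross product up to its determinant.\<close>
  have "det (matrix \<phi>) *\<^sub>R \<phi> (axis 3 1) = \<phi> (axis 3 1)"
    using cross_orthogonal_transformation[OF orth, of "axis 1 1" "axis 2 1"] cross[of "axis 1 1" "axis 2 1"]
    by (simp add: cross_basis)
  moreover have "\<phi> (axis 3 1) \<noteq> 0" using inj[of "axis 3 1"] by (auto simp: axis_eq_0_iff)
  ultimately have "det (matrix \<phi>) = 1" by (metis scaleR_cancel_right scaleR_one)
  then have "matrix \<phi> \<in> SO3"
    using orth by (simp add: SO3_def rotation_matrix_def orthogonal_transformation_matrix)
  moreover have "F (hat a ** X) = hat (matrix \<phi> *v a) ** F X" for a X
    using \<phi> \<open>linear \<phi>\<close> by (simp add: matrix_works)
  ultimately show ?thesis using that by blast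
qed

text \<open>After composition with the inverse rotation, \<open>F\<close> commutes with all left multiplications and is
  therefore a right multiplication by some \<open>C\<close>.\<close>

lemma left_normalizer:
  fixes F :: "real^3^3 \<Rightarrow> real^3^3"
  assumes "linear F" "bij F"
    and left: "\<And>a. \<exists>a'. \<forall>X. F (hat a ** X) = hat a' ** F X"
    and right: "\<And>b. \<exists>a' b'. \<forall>X. F (X ** hat b) = so3_so3 a' b' (F X)"
  obtains P Q c where "P \<in> SO3" "Q \<in> SO3" "\<And>X. F X = c *\<^sub>R (P ** X ** transpose Q)"
proof -
  obtain P where P: "P \<in> SO3" and FP: "\<And>a X. F (hat a ** X) = hat (P *v a) ** F X"
    using left_normalizer_rotation[OF assms(1-3)] by blast
  have rot: "rotation_matrix P" using P by (simp add: SO3_def)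
  then have PT: "P ** transpose P = mat 1" and TP: "transpose P ** P = mat 1"
    by (simp_all add: rotation_matrix_def orthogonal_matrix_def)
  define C where "C = transpose P ** F (mat 1)"
  have "transpose P ** F (M ** X) = M ** (transpose P ** F X)" for M X
  proof (rule hat_linear_imp_matrix_linear)
    show "linear (\<lambda>X. transpose P ** F X)"
      by (rule linearI) (simp_all add: matrix_mult_simps linear_add[OF \<open>linear F\<close>] linear_cmul[OF \<open>linear F\<close>])
    show "transpose P ** F (hat a ** X) = hat a ** (transpose P ** F X)" for a X
      by (simp add: FP hat_rotation[OF rot] matrix_mul_assoc TP)
  qed
  from this[where X = "mat 1"] have F1: "transpose P ** F X = X ** C" for X
    unfolding C_def by (metis matrix_mul_rid)
  have F: "F X = P ** X ** C" for X
    using arg_cong[OF F1[of X], of "\<lambda>M. P ** M"] by (simp add: matrix_mul_assoc PT)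
  obtain J where "F J = mat 1" using \<open>bij F\<close> by (metis bij_pointE)
  then obtain D where DC: "D ** C = mat 1" using F by metis
  then have CD: "C ** D = mat 1" using matrix_left_right_inverse by blast
  \<comment> \<open>Right multiplications are normalised as well, so conjugation by \<open>C\<close> preserves the skew matrices;
    comparing with the transposed relation shows that \<open>C C\<^sup>T\<close> is scalar, and so \<open>C\<close> is a multiple of an
    orthogonal matrix.\<close>
  have comm: "hat b ** (C ** transpose C) = (C ** transpose C) ** hat b" for b
  proof -
    obtain a' b' where ab: "\<And>X. F (X ** hat b) = so3_so3 a' b' (F X)" using right by blast
    have Y: "Y ** (D ** hat b ** C) = hat a' ** Y + Y ** hat b'" for Y
    proof -
      let ?X = "transpose P ** Y ** D"
      have "F ?X = Y" unfolding F
        by (simp add: matrix_mul_assoc PT) (simp add: DC flip: matrix_mul_assoc)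
      moreover have "F (?X ** hat b) = Y ** (D ** hat b ** C)" unfolding F
        by (simp add: matrix_mul_assoc PT)
      ultimately show ?thesis using ab[of ?X] by (simp add: so3_so3_def)
    qed
    have "hat a' ** Y = Y ** hat a'" for Y
      using Y[of Y] Y[of "mat 1"] by (simp add: matrix_mult_simps)
    then have "hat a' = (hat a' $ 1 $ 1) *\<^sub>R mat 1"
      by (intro commutes_with_hat_imp_scalar) metis
    then have "hat a' = 0" by (simp add: hat_def)
    then have "D ** hat b ** C = hat b'" using Y[of "mat 1"] by simp
    then have "C ** (D ** hat b ** C) = C ** hat b'" by simp
    then have 1: "hat b ** C = C ** hat b'" by (simp add: matrix_mul_assoc CD)
    then have "transpose (hat b ** C) = transpose (C ** hat b')" by simp
    then have 2: "hat b' ** transpose C = transpose C ** hat b"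
      by (simp add: matrix_transpose_mul transpose_hat matrix_mult_simps)
    show ?thesis
      by (metis 1 2 matrix_mul_assoc)
  qed
  define k where "k = (C ** transpose C) $ 1 $ 1"
  have CC: "C ** transpose C = k *\<^sub>R mat 1"
    unfolding k_def by (rule commutes_with_hat_imp_scalar[OF comm])
  have "k > 0"
  proof -
    have "k = C $ 1 \<bullet> C $ 1" by (simp add: k_def matrix_mult_transpose_dot_row row_def)
    moreover have "C $ 1 \<noteq> 0"
    proof
      assume "C $ 1 = 0"
      then have "(C ** D) $ 1 $ 1 = 0" by (simp add: matrix_matrix_mult_def)
      then show False by (simp add: CD mat_def)
    qed
    ultimately show ?thesis by simp
  qed
  define R where "R = (1 / sqrt k) *\<^sub>R C"
  have "R ** transpose R = mat 1"
    using \<open>k > 0\<close> by (simp add: R_def transpose_simps matrix_mult_simps CC)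
  then have R: "orthogonal_matrix R"
    by (metis orthogonal_matrix_def matrix_left_right_inverse)
  have det3: "det (c *\<^sub>R M) = c ^ 3 * det M" for c and M :: "real^3^3"
    by (simp add: det_3 power3_eq_cube algebra_simps)
  \<comment> \<open>In odd dimension a sign moves an orthogonal matrix into the rotation group; the sign is
    absorbed in the scalar \<open>c\<close>.\<close>
  define \<epsilon> where "\<epsilon> = det R"
  have \<epsilon>: "\<epsilon> = 1 \<or> \<epsilon> = -1" using det_orthogonal_matrix[OF R] by (simp add: \<epsilon>_def)
  define Q where "Q = transpose (\<epsilon> *\<^sub>R R)"
  have "orthogonal_matrix (\<epsilon> *\<^sub>R R)"
    using R \<epsilon> by (auto simp: orthogonal_matrix_def transpose_simps matrix_mult_simps)
  moreover have "det (\<epsilon> *\<^sub>R R) = 1"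
    using \<epsilon> by (auto simp: det3 simp flip: \<epsilon>_def)
  ultimately have "Q \<in> SO3" by (simp add: SO3_def Q_def rotation_matrix_def)
  moreover have "C = (sqrt k * \<epsilon>) *\<^sub>R transpose Q"
    using \<epsilon> \<open>k > 0\<close> by (auto simp: Q_def R_def)
  then have "F X = (sqrt k * \<epsilon>) *\<^sub>R (P ** X ** transpose Q)" for X
    unfolding F by (simp only: matrix_mult_simps)
  ultimately show ?thesis using that P by blast
qed

text \<open>The image of a left multiplication by \<open>hat a\<close> satisfies a cubic equation of the form
  \<open>T\<^sup>3 = - n T\<close>, so it is again purely a left or purely a right multiplication. By
  linearity the same alternative holds for all \<open>a\<close>, and the second alternative becomes the first
  after transposition.\<close>

theorem normalizer_so3_so3:
  fixes F :: "real^3^3 \<Rightarrow> real^3^3"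
  assumes "linear F" "bij F"
    and norm: "\<And>a b. \<exists>a' b'. \<forall>X. F (so3_so3 a b X) = so3_so3 a' b' (F X)"
  obtains P Q c where "P \<in> SO3" "Q \<in> SO3"
    "(\<forall>X. F X = c *\<^sub>R (P ** X ** transpose Q)) \<or> (\<forall>X. F X = c *\<^sub>R (P ** transpose X ** transpose Q))"
proof -
  note F = linear_add[OF \<open>linear F\<close>] linear_diff[OF \<open>linear F\<close>] linear_cmul[OF \<open>linear F\<close>]
  have surj: "\<exists>X. F X = Y" for Y using \<open>bij F\<close> by (metis bij_pointE)
  define L where "L a a' \<longleftrightarrow> (\<forall>X. F (hat a ** X) = hat a' ** F X)" for a a'
  define R where "R a b' \<longleftrightarrow> (\<forall>X. F (hat a ** X) = F X ** hat b')" for a b'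
  have LR: "(\<exists>a'. L a a') \<or> (\<exists>b'. R a b')" for a
  proof -
    obtain a' b' where ab: "\<And>X. F (hat a ** X) = so3_so3 a' b' (F X)"
      using norm[of a 0] by (auto simp: so3_so3_def matrix_mult_simps)
    have "so3_so3 a' b' (so3_so3 a' b' (so3_so3 a' b' Y)) = - (a \<bullet> a) *\<^sub>R so3_so3 a' b' Y" for Y
    proof -
      obtain X where X: "F X = Y" using surj by blast
      have "F (hat a ** (hat a ** (hat a ** X))) = F (- (a \<bullet> a) *\<^sub>R (hat a ** X))"
        using arg_cong[OF hat_cube[of a], of "\<lambda>M. F (M ** X)"]
        by (simp add: matrix_mul_assoc matrix_mult_simps)
      then show ?thesis by (simp only: ab F X)
    qed
    then have "a' = 0 \<or> b' = 0" by (rule so3_so3_cube)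
    then show ?thesis using ab by (auto simp: so3_so3_def L_def R_def matrix_mult_simps)
  qed
  have Ladd: "L (a + b) (a' + b')" if "L a a'" "L b b'" for a b a' b'
    using that by (simp add: L_def linear_add[OF linear_hat] matrix_mult_simps F)
  have Rdiff: "R (a - b) (a' - b')" if "R a a'" "R b b'" for a b a' b'
    using that by (simp add: R_def linear_diff[OF linear_hat] matrix_mult_simps F)
  \<comment> \<open>A vector space is not the union of two proper subspaces.\<close>
  have "(\<forall>a. \<exists>a'. L a a') \<or> (\<forall>a. \<exists>b'. R a b')"
  proof (rule ccontr)
    assume "\<not> ?thesis"
    then obtain x y where x: "\<nexists>a'. L x a'" and y: "\<nexists>b'. R y b'" by blast
    then obtain x' y' where x': "R x x'" and y': "L y y'" using LR by blast
    from LR[of "x - y"] show False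
    proof
      assume "\<exists>a'. L (x - y) a'"
      then show False using Ladd[OF _ y', of "x - y"] x by auto
    next
      assume "\<exists>b'. R (x - y) b'"
      then show False using Rdiff[OF x', of "x - y"] y by auto
    qed
  qed
  then show ?thesis
  proof
    assume "\<forall>a. \<exists>a'. L a a'"
    then have left: "\<exists>a'. \<forall>X. F (hat a ** X) = hat a' ** F X" for a by (simp add: L_def)
    have right: "\<exists>a' b'. \<forall>X. F (X ** hat b) = so3_so3 a' b' (F X)" for b
      using norm[of 0 b] by (simp add: so3_so3_def[of 0] matrix_mult_simps)
    show ?thesis
      by (rule left_normalizer[OF assms(1,2) left right]) (use that in blast)
  next
    assume "\<forall>a. \<exists>b'. R a b'"
    then have swap: "\<exists>b'. \<forall>X. F (hat a ** X) = F X ** hat b'" for a by (simp add: R_def)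
    \<comment> \<open>Transposing the values turns right multiplications into left multiplications.\<close>
    let ?F = "\<lambda>X. transpose (F X)"
    have "linear ?F"
      using linear_compose[OF \<open>linear F\<close> linear_transpose] by (simp add: o_def)
    moreover have "bij ?F"
    proof -
      have "bij (transpose :: real^3^3 \<Rightarrow> real^3^3)"
        by (rule involuntory_imp_bij) simp
      then show ?thesis using bij_comp[OF \<open>bij F\<close>] by (simp add: o_def)
    qed
    moreover have "\<exists>a'. \<forall>X. ?F (hat a ** X) = hat a' ** ?F X" for a
    proof -
      obtain b' where "\<And>X. F (hat a ** X) = F X ** hat b'" using swap by blast
      then have "?F (hat a ** X) = hat (- b') ** ?F X" for X
        by (simp add: transpose_simps transpose_hat linear_neg[OF linear_hat])
      then show ?thesis by blast
    qed
    moreover have "\<exists>a' b'. \<forall>X. ?F (X ** hat b) = so3_so3 a' b' (?F X)" for b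
    proof -
      obtain a' b' where "\<And>X. F (so3_so3 0 b X) = so3_so3 a' b' (F X)" using norm by blast
      then have "?F (X ** hat b) = so3_so3 (- b') (- a') (?F X)" for X
        by (simp add: so3_so3_def transpose_simps transpose_hat linear_neg[OF linear_hat] matrix_mult_simps)
      then show ?thesis by blast
    qed
    ultimately obtain P Q c where PQ: "P \<in> SO3" "Q \<in> SO3" "\<And>X. ?F X = c *\<^sub>R (P ** X ** transpose Q)"
      by (rule left_normalizer) blast
    have "F X = c *\<^sub>R (Q ** transpose X ** transpose P)" for X
      using arg_cong[OF PQ(3)[of X], of transpose] by (simp add: transpose_simps matrix_mul_assoc)
    then show ?thesis using that PQ by blast
  qed
qed

section \<open>Connectedness of SO(3)\<close>

text \<open>For a unit vector \<open>u\<close>, the rotation by \<open>\<pi>\<close> about the axis \<open>u\<close>.\<close>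

definition half_turn :: "real^3 \<Rightarrow> real^3^3" where
  "half_turn u = (\<chi> i j. 2 * u $ i * u $ j - (if i = j then 1 else 0))"

lemma half_turn_vector: "half_turn u *v x = (2 * (u \<bullet> x)) *\<^sub>R u - x"
  by (simp add: half_turn_def matrix_vector_mult_def inner_vec_def vec_eq_iff forall_3 sum_3 algebra_simps)

lemma half_turn_SO3:
  assumes "norm u = 1"
  shows "half_turn u \<in> SO3"
proof -
  have u: "u \<bullet> u = 1" using assms by (simp add: norm_eq_1)
  have "half_turn u *v (half_turn u *v x) = x" for x
  proof -
    have "u \<bullet> (half_turn u *v x) = u \<bullet> x"
      by (simp add: half_turn_vector inner_diff_right u)
    then show ?thesis using half_turn_vector[of u "half_turn u *v x"] half_turn_vector[of u x] by simp
  qed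
  then have "half_turn u ** half_turn u = mat 1"
    by (simp add: matrix_eq flip: matrix_vector_mul_assoc)
  moreover have "transpose (half_turn u) = half_turn u"
    by (simp add: half_turn_def transpose_def vec_eq_iff)
  moreover have "det (half_turn u) = 2 * (u \<bullet> u) - 1"
    by (simp add: half_turn_def det_3 inner_vec_def sum_3 algebra_simps)
  ultimately show ?thesis
    by (simp add: SO3_def rotation_matrix_def orthogonal_matrix_def u)
qed

lemma SO3_inner:
  assumes "R \<in> SO3"
  shows "(R *v x) \<bullet> (R *v y) = x \<bullet> y"
proof -
  have "orthogonal_transformation ((*v) R)"
    using assms by (simp add: SO3_def rotation_matrix_def orthogonal_transformation_matrix)
  then show ?thesis by (simp add: orthogonal_transformation_def)
qed

lemma SO3_axis:
  assumes "R \<in> SO3"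
  obtains w where "norm w = 1" "R *v w = w"
proof -
  have RT: "R ** transpose R = mat 1" and det: "det R = 1"
    using assms by (auto simp: SO3_def rotation_matrix_def orthogonal_matrix_def)
  \<comment> \<open>In odd dimension \<open>det (R - 1) = det (- R) det (R - 1) = - det (R - 1)\<close>.\<close>
  have "R - mat 1 = (- R) ** transpose (R - mat 1)"
    by (simp add: transpose_simps matrix_mult_simps RT)
  then have "det (R - mat 1) = det (- R) * det (R - mat 1)"
    by (metis det_mul det_transpose)
  also have "det (- R) = - det R" by (simp add: det_3)
  finally have "det (R - mat 1) = 0" using det by simp
  then have "\<not> (\<exists>B. B ** (R - mat 1) = mat 1)"
    by (metis det_mul det_I mult_zero_right zero_neq_one)
  then obtain x where x: "(R - mat 1) *v x = 0" "x \<noteq> 0"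
    by (auto simp: matrix_left_invertible_ker)
  then have "R *v x = x" by (simp add: matrix_vector_mult_diff_rdistrib)
  then have "R *v ((1 / norm x) *\<^sub>R x) = (1 / norm x) *\<^sub>R x"
    by (simp only: matrix_vector_mult_scaleR)
  moreover have "norm ((1 / norm x) *\<^sub>R x) = 1" using x by simp
  ultimately show ?thesis using that by blast
qed

text \<open>A rotation is determined by its values on two orthonormal vectors, since it preserves their cross product.\<close>

lemma SO3_eqI:
  assumes "R \<in> SO3" "S \<in> SO3" "R *v w = S *v w" "R *v v = S *v v"
    and w: "w \<bullet> w = 1" and v: "v \<bullet> v = 1" and wv: "w \<bullet> v = 0"
  shows "R = S"
proof -
  let ?n = "cross3 w v"
  have n: "R *v ?n = S *v ?n"
    using assms cross_rotation_matrix[of R w v] cross_rotation_matrix[of S w v] by (simp add: SO3_def)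
  have "R *v x = S *v x" for x
  proof -
    have "?n \<bullet> ?n = 1"
      using norm_cross_dot[of w v] w v wv by (simp add: norm_eq_sqrt_inner)
    then have "x = (?n \<bullet> ?n) *\<^sub>R x" by simp
    also have "\<dots> = (?n \<bullet> x) *\<^sub>R ?n + cross3 ?n (cross3 x ?n)"
      using Lagrange[of ?n x ?n] by simp
    also have "cross3 x ?n = (x \<bullet> v) *\<^sub>R w - (x \<bullet> w) *\<^sub>R v" by (simp add: Lagrange)
    also have "cross3 ?n \<dots> = (x \<bullet> v) *\<^sub>R v + (x \<bullet> w) *\<^sub>R w"
    proof -
      have "cross3 ?n w = v" "cross3 ?n v = - w"
        using w v wv by (simp_all add: cross_skew[of ?n] Lagrange inner_commute)
      then show ?thesis by (simp add: Cross3.right_diff_distrib cross_mult_right)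
    qed
    finally have x: "x = (?n \<bullet> x) *\<^sub>R ?n + ((x \<bullet> v) *\<^sub>R v + (x \<bullet> w) *\<^sub>R w)" (is "_ = ?e") .
    have "R *v x = R *v ?e" using x by (rule arg_cong)
    also have "\<dots> = S *v ?e"
      by (simp only: matrix_vector_right_distrib matrix_vector_mult_scaleR n assms(3,4))
    also have "\<dots> = S *v x" using x[symmetric] by (rule arg_cong)
    finally show ?thesis .
  qed
  then show ?thesis by (simp add: matrix_eq)
qed

text \<open>Every rotation has an axis \<open>w\<close>; it is the product of two half-turns about axes orthogonal to
  \<open>w\<close> that enclose half the angle.\<close>

lemma SO3_product_half_turns:
  assumes R: "R \<in> SO3"
  obtains u v where "norm u = 1" "norm v = 1" "R = half_turn u ** half_turn v"
proof -
  obtain w where w: "norm w = 1" "R *v w = w" using SO3_axis[OF R] .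
  obtain v0 where v0: "v0 \<noteq> 0" "orthogonal w v0"
    using orthogonal_to_vector_exists[of w] by auto
  define v where "v = (1 / norm v0) *\<^sub>R v0"
  have ww: "w \<bullet> w = 1" using w by (simp add: norm_eq_1)
  have v: "norm v = 1" and wv: "w \<bullet> v = 0"
    using v0 by (auto simp: v_def orthogonal_def)
  then have vv: "v \<bullet> v = 1" by (simp add: norm_eq_1)
  let ?y = "R *v v"
  have yy: "?y \<bullet> ?y = 1" by (simp add: SO3_inner[OF R] vv)
  have wy: "w \<bullet> ?y = 0" using SO3_inner[OF R, of w v] w(2) wv by simp
  \<comment> \<open>The half-turn about \<open>v\<close> fixes \<open>v\<close> and reverses \<open>w\<close>. The half-turn about the bisector of \<open>v\<close> and
    \<open>R v\<close> then takes \<open>v\<close> to \<open>R v\<close> and restores \<open>w\<close>; if \<open>R v = - v\<close>, the third axis replaces the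
    bisector.\<close>
  obtain u where u: "norm u = 1" "u \<bullet> w = 0" "half_turn u *v v = ?y"
  proof (cases "?y = - v")
    case True
    have "norm (cross3 w v) = 1"
      using norm_cross_dot[of w v] w v wv by (simp add: power2_eq_1_iff) (smt (verit) norm_ge_zero)
    moreover have "cross3 w v \<bullet> w = 0" "cross3 w v \<bullet> v = 0" by (simp_all add: dot_cross_self inner_commute)
    ultimately show ?thesis using True by (intro that[of "cross3 w v"]) (simp_all add: half_turn_vector)
  next
    case False
    define s where "s = v + ?y"
    have s: "s \<noteq> 0" using False by (simp add: s_def add_eq_0_iff)
    have ss: "s \<bullet> s = 2 * (s \<bullet> v)" by (simp add: s_def inner_add_left inner_add_right vv yy inner_commute)
    let ?u = "(1 / norm s) *\<^sub>R s"
    have "(2 * (?u \<bullet> v)) *\<^sub>R ?u = (2 * (s \<bullet> v) / (s \<bullet> s)) *\<^sub>R s"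
      by (simp add: dot_square_norm power2_eq_square)
    also have "\<dots> = s" using s by (simp flip: ss)
    finally have "half_turn ?u *v v = ?y" by (simp add: half_turn_vector s_def)
    moreover have "s \<bullet> w = 0" using wv wy by (simp add: s_def inner_add_left inner_add_right inner_commute)
    ultimately show ?thesis using s by (intro that[of ?u]) simp_all
  qed
  have "R = half_turn u ** half_turn v"
  proof (rule SO3_eqI[OF R _ _ _ ww vv wv])
    show "half_turn u ** half_turn v \<in> SO3" using half_turn_SO3 u(1) v SO3_mult by blast
    have "half_turn v *v v = v" by (simp add: half_turn_vector vv scaleR_2)
    then show "R *v v = half_turn u ** half_turn v *v v"
      by (simp add: u(3) flip: matrix_vector_mul_assoc)
    have "half_turn v *v w = - w" using wv by (simp add: half_turn_vector inner_commute)
    moreover have "half_turn u *v (- w) = w" using u(2) by (simp add: half_turn_vector)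
    ultimately show "R *v w = half_turn u ** half_turn v *v w"
      by (simp add: w(2) flip: matrix_vector_mul_assoc)
  qed
  then show ?thesis using that u(1) v by blast
qed

text \<open>Half-turns are parametrised by the sphere, so the group is a continuous image of a product of two spheres.\<close>

lemma connected_SO3: "connected SO3"
proof -
  let ?S = "sphere (0::real^3) 1"
  let ?f = "\<lambda>p. half_turn (fst p) ** half_turn (snd p)"
  have "SO3 = ?f ` (?S \<times> ?S)"
  proof
    show "SO3 \<subseteq> ?f ` (?S \<times> ?S)"
    proof
      fix R assume "R \<in> SO3"
      then obtain u v where "norm u = 1" "norm v = 1" "R = half_turn u ** half_turn v"
        by (rule SO3_product_half_turns)
      then show "R \<in> ?f ` (?S \<times> ?S)" by (intro image_eqI[of _ _ "(u, v)"]) auto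
    qed
    show "?f ` (?S \<times> ?S) \<subseteq> SO3" by (auto intro!: SO3_mult half_turn_SO3)
  qed
  moreover have "continuous_on (?S \<times> ?S) ?f"
  proof (rule bounded_bilinear.continuous_on[OF bounded_bilinear_matrix_mult])
    have "continuous_on UNIV half_turn"
      unfolding half_turn_def by (intro continuous_intros)
    then show "continuous_on (?S \<times> ?S) (\<lambda>p. half_turn (fst p))"
      "continuous_on (?S \<times> ?S) (\<lambda>p. half_turn (snd p))"
      by (auto intro!: continuous_on_compose2[of UNIV half_turn] continuous_on_fst continuous_on_snd continuous_on_id)
  qed
  moreover have "connected (?S \<times> ?S)" by (intro connected_Times connected_sphere) simp_all
  ultimately show ?thesis using connected_continuous_image[of "?S \<times> ?S" ?f] by simp
qed

section \<open>The representation is faithful and irreducible\<close>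

lemma linear_inv_sigma: "linear (inv sigma9)"
  by (rule linearI; rule injD[OF inj_sigma])
     (simp_all add: linear_add[OF linear_sigma] linear_cmul[OF linear_sigma])

lemma inv_sigma_sigma [simp]: "inv sigma9 (sigma9 a) = a"
  by (rule inv_f_f[OF inj_sigma])

lemma sigma_rho_SO3: "h \<in> SO3 \<times> SO3 \<Longrightarrow> sigma9 (rho h *v a) = fst h ** sigma9 a ** transpose (snd h)"
  by (auto simp: sigma_rho matrix_inv_SO3(2))

lemma SO3_transpose: "R \<in> SO3 \<Longrightarrow> transpose R \<in> SO3"
  by (simp add: SO3_def rotation_matrix_def)

lemma mat_1_SO3: "mat 1 \<in> SO3"
  by (simp add: SO3_def rotation_matrix_def orthogonal_matrix_id)

lemma SO3_orthogonal: "R \<in> SO3 \<Longrightarrow> R ** transpose R = mat 1" "R \<in> SO3 \<Longrightarrow> transpose R ** R = mat 1"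
  by (auto simp: SO3_def rotation_matrix_def orthogonal_matrix_def)

lemma det_SO3: "R \<in> SO3 \<Longrightarrow> det R = 1"
  by (simp add: SO3_def rotation_matrix_def)

lemma mat_1_rho: "mat 1 \<in> rho ` (SO3 \<times> SO3)"
proof -
  have "rho (mat 1, mat 1) *v a = a" for a
    by (rule injD[OF inj_sigma]) (simp add: sigma_rho_SO3 mat_1_SO3)
  then have "mat 1 = rho (mat 1, mat 1)" by (simp add: matrix_eq)
  then show ?thesis using mat_1_SO3 by blast
qed

text \<open>If two pairs of rotations act in the same way, then their quotient \<open>M, N\<close> satisfies
  \<open>M X = X N\<close> for all \<open>X\<close>; hence \<open>M = N\<close> is scalar, and its
  determinant is \<open>1\<close>.\<close>

lemma inj_on_rho: "inj_on rho (SO3 \<times> SO3)"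
proof (rule inj_onI, clarify)
  fix L R L' R'
  assume SO: "L \<in> SO3" "R \<in> SO3" "L' \<in> SO3" "R' \<in> SO3" and eq: "rho (L, R) = rho (L', R')"
  define M where "M = transpose L' ** L"
  have LRX: "L ** X ** transpose R = L' ** X ** transpose R'" for X
    using sigma_rho_SO3[of "(L, R)" "inv sigma9 X"] sigma_rho_SO3[of "(L', R')" "inv sigma9 X"] SO eq
    by simp
  have MX: "M ** X = X ** (transpose R' ** R)" for X
  proof -
    have "M ** X = transpose L' ** (L ** X ** transpose R) ** R"
      by (simp add: M_def SO3_orthogonal SO flip: matrix_mul_assoc)
    also have "\<dots> = (transpose L' ** L') ** X ** (transpose R' ** R)"
      by (simp only: LRX matrix_mul_assoc)
    finally show ?thesis by (simp add: SO3_orthogonal SO)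
  qed
  have "hat b ** M = M ** hat b" for b using MX[of "hat b"] MX[of "mat 1"] by simp
  then obtain k where k: "M = k *\<^sub>R mat 1" using commutes_with_hat_imp_scalar by blast
  have "det M = 1" using SO by (simp add: M_def det_mul det_SO3)
  then have "k ^ 3 = 1" by (simp add: k det_3 mat_def power3_eq_cube)
  \<comment> \<open>\<open>k\<^sup>2 + k + 1\<close> as a sum of squares has no real zero.\<close>
  then have "(k - 1) * ((k + 1/2)\<^sup>2 + 3/4) = 0" by (simp add: algebra_simps power2_eq_square power3_eq_cube)
  moreover have "(k + 1/2)\<^sup>2 + 3/4 > 0" by (simp add: add_nonneg_pos)
  ultimately have "k = 1" by simp
  then have M: "M = mat 1" by (simp add: k)
  then have "L' ** (transpose L' ** L) = L'" by (simp add: M_def)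
  then have L: "L = L'" by (simp add: matrix_mul_assoc SO3_orthogonal SO)
  have "transpose R' ** R = mat 1" using MX[of "mat 1"] M by simp
  then have "R' ** (transpose R' ** R) = R'" by simp
  then have "R = R'" by (simp add: matrix_mul_assoc SO3_orthogonal SO)
  with L show "L = L' \<and> R = R'" by simp
qed

lemma sandwich_munit_transpose:
  assumes "P *v axis i 1 = axis j 1" "Q *v axis p 1 = axis q 1"
  shows "P ** munit i p ** transpose Q = munit j q"
proof -
  have col: "M $ a $ i = (M *v axis i 1) $ a" for M :: "real^3^3" and a i
    by (simp add: matrix_vector_mult_def axis_def if_distrib[of "\<lambda>x. _ * x"] cong: if_cong)
  have "P $ a $ i = axis j 1 $ a" "Q $ b $ p = axis q 1 $ b" for a b
    by (simp_all only: col[of P] col[of Q] assms)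
  then show ?thesis
    unfolding vec_eq_iff sandwich_munit by (simp add: transpose_def axis_def)
qed

lemma SO3_transitive_on_axes:
  obtains P where "P \<in> SO3" "P *v axis i 1 = axis j 1"
  using rotation_matrix_exists_basis[of "axis j (1::real) :: real^3" i] by (auto simp: SO3_def)

text \<open>Half-turns about the coordinate axes project a nonzero element to a multiple of a matrix unit, and rotations
  of the axes move this matrix unit to all others.\<close>

lemma invariant_subspace_trivial:
  assumes V: "subspace V"
    and inv: "\<And>P Q X. P \<in> SO3 \<Longrightarrow> Q \<in> SO3 \<Longrightarrow> X \<in> V \<Longrightarrow> P ** X ** transpose Q \<in> V"
    and X: "X \<in> V" "X \<noteq> 0"
  shows "V = UNIV"
proof -
  obtain i p where ip: "X $ i $ p \<noteq> 0" using X(2) by (auto simp: vec_eq_iff)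
  \<comment> \<open>Averaging over \<open>1\<close> and the half-turn about an axis projects onto a single row or column.\<close>
  have half: "mat 1 + half_turn (axis i 1) = 2 *\<^sub>R munit i i"
    "mat 1 + transpose (half_turn (axis i 1)) = 2 *\<^sub>R munit i i" for i
    by (auto simp: half_turn_def vec_eq_iff mat_def axis_def transpose_def)
  have ht: "half_turn (axis i 1) \<in> SO3" for i by (simp add: half_turn_SO3)
  have "munit i i ** X \<in> V"
  proof -
    have "(1/2) *\<^sub>R (X + half_turn (axis i 1) ** X) \<in> V"
      using inv[OF ht[of i] mat_1_SO3 X(1)] V X(1) by (simp add: subspace_add subspace_scale)
    also have "X + half_turn (axis i 1) ** X = (2 *\<^sub>R munit i i) ** X"
      unfolding half(1)[symmetric] by (simp add: matrix_mult_simps)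
    finally show ?thesis by (simp add: matrix_mult_simps)
  qed
  moreover have "Y ** munit p p \<in> V" if Y: "Y \<in> V" for Y
  proof -
    have "(1/2) *\<^sub>R (Y + Y ** transpose (half_turn (axis p 1))) \<in> V"
      using inv[OF mat_1_SO3 ht[of p] Y] V Y by (simp add: subspace_add subspace_scale)
    also have "Y + Y ** transpose (half_turn (axis p 1)) = Y ** (2 *\<^sub>R munit p p)"
      unfolding half(2)[symmetric] by (simp add: matrix_mult_simps)
    finally show ?thesis by (simp add: matrix_mult_simps)
  qed
  ultimately have "munit i i ** X ** munit p p \<in> V" by blast
  moreover have "munit i i ** X ** munit p p = X $ i $ p *\<^sub>R munit i p"
  proof -
    have "(munit i i ** X ** munit p p) $ a $ b = (X $ i $ p *\<^sub>R munit i p) $ a $ b" for a b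
    proof -
      have "(munit i i ** X) $ a $ c = (if a = i then X $ i $ c else 0)" for c
        by (auto simp: matrix_matrix_mult_def if_distrib[of "\<lambda>x. x * _"] cong: if_cong)
      then show ?thesis
        by (simp add: matrix_matrix_mult_def[of "munit i i ** X"] if_distrib[of "\<lambda>x. _ * x"] cong: if_cong)
    qed
    then show ?thesis by (simp add: vec_eq_iff)
  qed
  ultimately have "(1 / X $ i $ p) *\<^sub>R (X $ i $ p *\<^sub>R munit i p) \<in> V"
    using V by (metis subspace_scale)
  then have "munit i p \<in> V" using ip by simp
  then have "munit j q \<in> V" for j q
  proof -
    obtain P where P: "P \<in> SO3" "P *v axis i 1 = axis j 1" using SO3_transitive_on_axes .
    obtain Q where Q: "Q \<in> SO3" "Q *v axis p 1 = axis q 1" using SO3_transitive_on_axes .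
    show ?thesis using inv[OF P(1) Q(1) \<open>munit i p \<in> V\<close>] by (simp add: sandwich_munit_transpose[OF P(2) Q(2)])
  qed
  then have "(\<Sum>i\<in>UNIV. \<Sum>p\<in>UNIV. Y $ i $ p *\<^sub>R munit i p) \<in> V" for Y
    by (intro subspace_sum[OF V] subspace_scale[OF V])
  then have "Y \<in> V" for Y by (simp flip: matrix_eq_sum_munit)
  then show ?thesis by blast
qed

lemma irreducible_rho: "irreducible_matrices (rho ` (SO3 \<times> SO3))"
  unfolding irreducible_matrices_def
proof (intro allI impI)
  fix W :: "(real^9) set"
  assume W: "subspace W \<and> (\<forall>A\<in>rho ` (SO3 \<times> SO3). \<forall>v\<in>W. A *v v \<in> W)"
  show "W = {0} \<or> W = UNIV"
  proof (cases "W = {0}")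
    case False
    then obtain x where x: "x \<in> W" "x \<noteq> 0" using W subspace_0 by blast
    have "sigma9 ` W = UNIV"
    proof (rule invariant_subspace_trivial)
      show "subspace (sigma9 ` W)" using W linear_subspace_image[OF linear_sigma] by blast
      show "sigma9 x \<in> sigma9 ` W" using x by blast
      show "sigma9 x \<noteq> 0" using x inj_sigma linear_0[OF linear_sigma] by (metis injD)
      fix P Q X assume PQ: "P \<in> SO3" "Q \<in> SO3" and "X \<in> sigma9 ` W"
      then obtain a where a: "a \<in> W" "X = sigma9 a" by blast
      have "P ** X ** transpose Q = sigma9 (rho (P, Q) *v a)" by (simp add: sigma_rho_SO3 PQ a)
      moreover have "rho (P, Q) *v a \<in> W" using W PQ a by blast
      ultimately show "P ** X ** transpose Q \<in> sigma9 ` W" by blast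
    qed
    then have "W = UNIV" using inj_sigma by (metis inj_image_eq_iff surj_sigma)
    then show ?thesis ..
  qed simp
qed

section \<open>The image of the representation as an identity component\<close>

lemma rho_GL9:
  assumes "h \<in> SO3 \<times> SO3"
  shows "rho h \<in> GL9"
proof -
  define k where "k = (transpose (fst h), transpose (snd h))"
  have k: "k \<in> SO3 \<times> SO3" using assms by (auto simp: k_def SO3_transpose)
  have o: "fst h \<in> SO3" "snd h \<in> SO3" using assms by auto
  have "sigma9 (rho h *v (rho k *v a)) = sigma9 a" for a
  proof -
    have "sigma9 (rho h *v (rho k *v a)) = (fst h ** transpose (fst h)) ** sigma9 a ** (snd h ** transpose (snd h))"
      by (simp add: sigma_rho_SO3 assms k) (simp add: k_def matrix_mul_assoc)
    then show ?thesis by (simp add: SO3_orthogonal o)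
  qed
  then have "rho h *v (rho k *v a) = a" for a by (metis inj_sigma injD)
  then have "rho h ** rho k = mat 1" by (simp add: matrix_eq flip: matrix_vector_mul_assoc)
  then show ?thesis unfolding GL9_def by (auto simp: invertible_right_inverse)
qed

lemma connected_rho: "connected (rho ` (SO3 \<times> SO3))"
proof -
  let ?r = "\<lambda>h. matrix (\<lambda>a. inv sigma9 (fst h ** sigma9 a ** transpose (snd h)))"
  have "continuous_on (SO3 \<times> SO3) ?r"
    unfolding matrix_def
    by (intro continuous_intros
      bounded_linear.continuous_on[OF linear_conv_bounded_linear[THEN iffD1, OF linear_inv_sigma]]
      bounded_bilinear.continuous_on[OF bounded_bilinear_matrix_mult]
      bounded_linear.continuous_on[OF linear_conv_bounded_linear[THEN iffD1, OF linear_transpose]])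
  moreover have "rho ` (SO3 \<times> SO3) = ?r ` (SO3 \<times> SO3)"
    by (rule image_cong) (auto simp: rho_def matrix_inv_SO3(2))
  ultimately show ?thesis
    using connected_continuous_image[of "SO3 \<times> SO3" ?r] connected_Times[OF connected_SO3 connected_SO3]
    by simp
qed

lemma continuous_on_det: "continuous_on S (det :: real^'n^'n \<Rightarrow> real)"
  unfolding det_def by (intro continuous_intros)

text \<open>Along a connected set of invertible matrices the determinant cannot change sign.\<close>

lemma det_pos_of_connected:
  fixes K :: "(real^'n^'n) set"
  assumes "connected K" "mat 1 \<in> K" "\<And>A. A \<in> K \<Longrightarrow> invertible A" "A \<in> K"
  shows "det A > 0"
proof (rule ccontr)
  assume "\<not> det A > 0"
  have "connected (det ` K)"
    using connected_continuous_image[OF continuous_on_det \<open>connected K\<close>] .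
  moreover have "det A \<in> det ` K" "1 \<in> det ` K"
    using assms by (auto intro: image_eqI[of _ _ "mat 1"])
  ultimately have "0 \<in> det ` K" using \<open>\<not> det A > 0\<close> connectedD_interval[of "det ` K" "det A" 1 0] by auto
  then show False using assms(3) by (auto simp: invertible_det_nz)
qed

text \<open>Determinants are positive on the identity component, which is thus contained in \<open>K\<close>; conversely
  \<open>K\<close> is connected.\<close>

lemma identity_component_eq:
  assumes S: "S \<subseteq> GL9" and K: "{A \<in> S. det A > 0} = K" "connected K" "mat 1 \<in> K"
  shows "connected_component_set S (mat 1) = K"
proof
  show "K \<subseteq> connected_component_set S (mat 1)"
    using K by (intro connected_component_maximal) auto
  show "connected_component_set S (mat 1) \<subseteq> K"
  proof
    fix A assume A: "A \<in> connected_component_set S (mat 1)"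
    have sub: "connected_component_set S (mat 1) \<subseteq> S" by (rule connected_component_subset)
    have "det A > 0"
    proof (rule det_pos_of_connected[OF connected_connected_component _ _ A])
      show "mat 1 \<in> connected_component_set S (mat 1)" using K by (auto simp: connected_component_refl)
      show "invertible B" if "B \<in> connected_component_set S (mat 1)" for B
        using that sub S by (auto simp: GL9_def)
    qed
    then show "A \<in> K" using A sub K by auto
  qed
qed

lemma det_rho_pos: "h \<in> SO3 \<times> SO3 \<Longrightarrow> det (rho h) > 0"
  using det_pos_of_connected[OF connected_rho mat_1_rho, of "rho h"] rho_GL9 by (auto simp: GL9_def)

section \<open>The stabilisers\<close>

lemma metric_g_sigma: "metric_g u v = sigma9 u \<bullet> sigma9 v"
proof -
  have UNIV_9: "(UNIV :: 9 set) = {1, 2, 3, 4, 5, 6, 7, 8, 9}" by (simp add: set_eq_iff forall_9)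
  show ?thesis
    unfolding metric_g_def UNIV_9 theta_def inner_vec_def sum_3 sigma_entries by (simp add: add_ac)
qed

lemma inner_SO3_mult:
  assumes "P \<in> SO3" "Q \<in> SO3"
  shows "(P ** X ** transpose Q) \<bullet> (P ** Y ** transpose Q) = X \<bullet> Y"
proof -
  have "(P ** X ** transpose Q) \<bullet> (P ** Y ** transpose Q) = (P ** X) \<bullet> (P ** Y ** transpose Q ** Q)"
    by (simp only: inner_matrix_mult(2)[of "P ** X" "transpose Q"] transpose_transpose)
  also have "P ** Y ** transpose Q ** Q = P ** Y"
    by (simp add: SO3_orthogonal assms flip: matrix_mul_assoc)
  also have "(P ** X) \<bullet> (P ** Y) = X \<bullet> Y"
    by (simp add: inner_matrix_mult(1)[of P] SO3_orthogonal assms matrix_mul_assoc)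
  finally show ?thesis .
qed

lemma det_SO3_mult: "P \<in> SO3 \<Longrightarrow> Q \<in> SO3 \<Longrightarrow> det (P ** X ** transpose Q) = det X"
  by (simp add: det_mul det_SO3)

lemma omega_mat_SO3_mult:
  assumes "P \<in> SO3" "Q \<in> SO3"
  shows "omega_mat (P ** X ** transpose Q) (P ** Y ** transpose Q) (P ** Z ** transpose Q) (P ** W ** transpose Q)
    = omega_mat X Y Z W"
proof -
  have "skew_prod (P ** X ** transpose Q) (P ** Y ** transpose Q) = Q ** skew_prod X Y ** transpose Q" for X Y
  proof -
    have "transpose (P ** X ** transpose Q) ** (P ** Y ** transpose Q)
      = Q ** (transpose X ** (transpose P ** P) ** Y) ** transpose Q" for X Y
      by (simp only: matrix_transpose_mul transpose_transpose matrix_mul_assoc)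
    then show ?thesis by (simp add: skew_prod_def SO3_orthogonal assms matrix_mult_simps)
  qed
  then show ?thesis by (simp add: omega_mat_def inner_SO3_mult assms)
qed

lemma omega_mat_scaleR: "omega_mat (c *\<^sub>R X) (c *\<^sub>R Y) (c *\<^sub>R Z) (c *\<^sub>R W) = c ^ 4 * omega_mat X Y Z W"
proof -
  have "skew_prod (c *\<^sub>R X) (c *\<^sub>R Y) = (c * c) *\<^sub>R skew_prod X Y" for X Y
    by (simp add: skew_prod_def transpose_simps matrix_mult_simps scaleR_diff_right)
  then show ?thesis by (simp add: omega_mat_def power4_eq_xxxx algebra_simps)
qed

lemma rho_in_stab_g_Upsilon: "h \<in> SO3 \<times> SO3 \<Longrightarrow> rho h \<in> stab_g_Upsilon"
  by (auto simp: stab_g_Upsilon_def rho_GL9 metric_g_sigma sigma_rho_SO3 inner_SO3_mult Upsilon_def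
      linear_add[OF linear_sigma] det_SO3_mult simp flip: matrix_vector_right_distrib)

lemma rho_in_stab_omega: "h \<in> SO3 \<times> SO3 \<Longrightarrow> rho h \<in> stab_omega"
  by (auto simp: stab_omega_def rho_GL9 omega_eq_omega_mat sigma_rho_SO3 omega_mat_SO3_mult)

definition matrix_action :: "real^9^9 \<Rightarrow> real^3^3 \<Rightarrow> real^3^3" where
  "matrix_action A X = sigma9 (A *v inv sigma9 X)"

lemma matrix_action_sigma: "matrix_action A (sigma9 a) = sigma9 (A *v a)"
  by (simp add: matrix_action_def)

lemma matrix_action_eqI:
  assumes "\<And>X. matrix_action A X = matrix_action B X"
  shows "A = B"
proof -
  have "A *v a = B *v a" for a
    using assms[of "sigma9 a"] by (simp add: matrix_action_sigma inj_eq[OF inj_sigma])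
  then show ?thesis by (simp add: matrix_eq)
qed

lemma linear_matrix_action: "linear (matrix_action A)"
  by (rule linearI)
     (simp_all add: matrix_action_def linear_add[OF linear_inv_sigma] linear_cmul[OF linear_inv_sigma]
       linear_add[OF linear_sigma] linear_cmul[OF linear_sigma] matrix_vector_right_distrib matrix_vector_mult_scaleR)

lemma bij_matrix_action:
  assumes "A \<in> GL9"
  shows "bij (matrix_action A)"
proof -
  obtain B where B: "A ** B = mat 1" "B ** A = mat 1"
    using assms by (auto simp: GL9_def invertible_def)
  have "matrix_action B (matrix_action A X) = X" "matrix_action A (matrix_action B X) = X" for X
    by (simp_all add: matrix_action_def matrix_vector_mul_assoc B)
  then show ?thesis by (intro o_bij[of "matrix_action B"]) (auto simp: fun_eq_iff)
qed

lemma matrix_action_rho: "P \<in> SO3 \<Longrightarrow> Q \<in> SO3 \<Longrightarrow> matrix_action (rho (P, Q)) X = P ** X ** transpose Q"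
  by (simp add: matrix_action_def sigma_rho_SO3)

lemma matrix_action_transposition9: "matrix_action transposition9 X = transpose X"
  by (simp add: matrix_action_def sigma_transposition9)

text \<open>The conjugate of an element of the Lie algebra by \<open>F\<close>, characterised without the inverse of
  \<open>F\<close>.\<close>

lemma conjugate_so3_so3:
  fixes F :: "real^3^3 \<Rightarrow> real^3^3"
  assumes "linear F" "bij F"
  obtains m where "linear m" "\<And>X. m (F X) = F (so3_so3 a b X)"
proof
  have "linear (inv F)" using assms by (simp add: inj_linear_imp_inv_linear bij_is_inj)
  from linear_compose[OF linear_compose[OF this linear_so3_so3] \<open>linear F\<close>]
  show "linear (\<lambda>X. F (so3_so3 a b (inv F X)))" by (simp add: o_def)
  show "F (so3_so3 a b (inv F (F X))) = F (so3_so3 a b X)" for X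
    using assms by (simp add: bij_is_inj)
qed

text \<open>Conjugation by \<open>A\<close> preserves the Lie algebra annihilating \<open>\<omega>\<close>, so
  \<open>A\<close> lies in the normaliser, whose elements change \<open>\<omega>\<close> by the factor
  \<open>c\<^sup>4\<close> or, with a transposition, by \<open>- c\<^sup>4\<close>.\<close>

lemma stab_omega_cases:
  assumes A: "A \<in> stab_omega"
  obtains P Q where "P \<in> SO3" "Q \<in> SO3" "A = rho (P, Q) \<or> A = - rho (P, Q)"
proof -
  let ?F = "matrix_action A"
  have GL: "A \<in> GL9" using A by (simp add: stab_omega_def)
  note F = linear_matrix_action[of A] bij_matrix_action[OF GL]
  have inv: "omega_mat (?F X) (?F Y) (?F Z) (?F W) = omega_mat X Y Z W" for X Y Z W
    using A omega_eq_omega_mat[of "inv sigma9 X" "inv sigma9 Y" "inv sigma9 Z" "inv sigma9 W"]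
    by (simp add: stab_omega_def matrix_action_def flip: omega_eq_omega_mat)
  have "\<exists>a' b'. \<forall>X. ?F (so3_so3 a b X) = so3_so3 a' b' (?F X)" for a b
  proof -
    obtain m where m: "linear m" "\<And>X. m (?F X) = ?F (so3_so3 a b X)"
      using conjugate_so3_so3[OF F] by blast
    have "omega_mat (m X) Y Z W + omega_mat X (m Y) Z W
      + omega_mat X Y (m Z) W + omega_mat X Y Z (m W) = 0" for X Y Z W
    proof -
      obtain X' Y' Z' W' where "X = ?F X'" "Y = ?F Y'" "Z = ?F Z'" "W = ?F W'"
        using F(2) by (metis bij_pointE)
      then show ?thesis by (simp add: m(2) inv so3_so3_annihilates_omega_mat)
    qed
    then obtain a' b' where "m = so3_so3 a' b'" using omega_mat_annihilator[OF m(1)] by blast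
    then show ?thesis using m(2) by metis
  qed
  then obtain P Q c where PQ: "P \<in> SO3" "Q \<in> SO3" and
    alt: "(\<forall>X. ?F X = c *\<^sub>R (P ** X ** transpose Q)) \<or> (\<forall>X. ?F X = c *\<^sub>R (P ** transpose X ** transpose Q))"
    by (rule normalizer_so3_so3[OF F])
  have unit: "omega_mat (munit 1 1) (munit 1 2) (munit 2 1) (munit 2 2) = 1"
    "omega_mat (munit 1 1) (munit 2 1) (munit 1 2) (munit 2 2) = - 1"
    by (simp_all add: omega_mat_munit_first minor_sum_munit_first sum_3)
  have tr: "transpose (munit i j) = munit j i" for i j by (auto simp: transpose_def vec_eq_iff)
  from alt show ?thesis
  proof
    assume F': "\<forall>X. ?F X = c *\<^sub>R (P ** X ** transpose Q)"
    have "c ^ 4 = 1"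
      using inv[of "munit 1 1" "munit 1 2" "munit 2 1" "munit 2 2"]
      by (simp add: F' omega_mat_scaleR omega_mat_SO3_mult PQ unit)
    then have "(c - 1) * (c + 1) * (c * c + 1) = 0" by (simp add: algebra_simps power4_eq_xxxx)
    moreover have "c * c + 1 > 0" by (simp add: add_nonneg_pos)
    ultimately have "c = 1 \<or> c = - 1" by auto
    moreover have "A = c *\<^sub>R rho (P, Q)"
      using F' by (intro matrix_action_eqI)
       (simp add: matrix_action_rho PQ matrix_action_def[of "c *\<^sub>R _"] linear_cmul[OF linear_sigma]
         flip: scaleR_matrix_vector_assoc matrix_action_def)
    ultimately show ?thesis using that[OF PQ] by auto
  next
    assume F': "\<forall>X. ?F X = c *\<^sub>R (P ** transpose X ** transpose Q)"
    \<comment> \<open>Transposition reverses the sign of the form.\<close>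
    have "- (c ^ 4) = 1"
      using inv[of "munit 1 1" "munit 1 2" "munit 2 1" "munit 2 2"]
      by (simp add: F' omega_mat_scaleR omega_mat_SO3_mult PQ unit tr)
    moreover have "c ^ 4 \<ge> 0" by simp
    ultimately show ?thesis by linarith
  qed
qed

text \<open>As for \<open>\<omega>\<close>, the map \<open>A\<close> lies in the normaliser. The metric and the cubic form
  scale by \<open>c\<^sup>2\<close> and \<open>c\<^sup>3\<close>, also in the presence of a transposition, and
  so \<open>c = 1\<close>.\<close>

lemma stab_g_Upsilon_cases:
  assumes A: "A \<in> stab_g_Upsilon"
  obtains P Q where "P \<in> SO3" "Q \<in> SO3" "A = rho (P, Q) \<or> A = rho (P, Q) ** transposition9"
proof -
  let ?F = "matrix_action A"
  have GL: "A \<in> GL9" using A by (simp add: stab_g_Upsilon_def)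
  note F = linear_matrix_action[of A] bij_matrix_action[OF GL]
  have inner: "?F X \<bullet> ?F Y = X \<bullet> Y" for X Y
    using A metric_g_sigma[of "inv sigma9 X" "inv sigma9 Y"]
    by (simp add: stab_g_Upsilon_def matrix_action_def flip: metric_g_sigma)
  have polar: "det_polar (?F X) (?F Y) (?F Z) = det_polar X Y Z" for X Y Z
    using A Upsilon_eq_det_polar[of "inv sigma9 X" "inv sigma9 Y" "inv sigma9 Z"]
    by (simp add: stab_g_Upsilon_def matrix_action_def flip: Upsilon_eq_det_polar)
  have det: "det (?F X) = det X" for X using polar[of X X X] by (simp add: det_polar_diag)
  have "\<exists>a' b'. \<forall>X. ?F (so3_so3 a b X) = so3_so3 a' b' (?F X)" for a b
  proof -
    obtain m where m: "linear m" "\<And>X. m (?F X) = ?F (so3_so3 a b X)"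
      using conjugate_so3_so3[OF F] by blast
    have "m X \<bullet> Y + X \<bullet> m Y = 0" for X Y
    proof -
      obtain X' Y' where "X = ?F X'" "Y = ?F Y'" using F(2) by (metis bij_pointE)
      then show ?thesis by (simp add: m(2) inner so3_so3_annihilates_inner)
    qed
    moreover have "det_polar (m X) Y Z + det_polar X (m Y) Z + det_polar X Y (m Z) = 0" for X Y Z
    proof -
      obtain X' Y' Z' where "X = ?F X'" "Y = ?F Y'" "Z = ?F Z'" using F(2) by (metis bij_pointE)
      then show ?thesis by (simp add: m(2) polar so3_so3_annihilates_det_polar)
    qed
    ultimately obtain a' b' where "m = so3_so3 a' b'" using metric_det_annihilator[OF m(1)] by blast
    then show ?thesis using m(2) by metis
  qed
  then obtain P Q c where PQ: "P \<in> SO3" "Q \<in> SO3" and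
    alt: "(\<forall>X. ?F X = c *\<^sub>R (P ** X ** transpose Q)) \<or> (\<forall>X. ?F X = c *\<^sub>R (P ** transpose X ** transpose Q))"
    by (rule normalizer_so3_so3[OF F])
  have F1: "?F (mat 1) = c *\<^sub>R (P ** mat 1 ** transpose Q)" using alt by auto
  have "mat 1 \<bullet> (mat 1 :: real^3^3) = 3" by (simp add: inner_vec_def sum_3 mat_def)
  then have "c * c = 1"
    using inner[of "mat 1" "mat 1"] inner_SO3_mult[OF PQ, of "mat 1" "mat 1"] unfolding F1 by simp
  moreover have "c ^ 3 = 1"
  proof -
    have "det (c *\<^sub>R M) = c ^ 3 * det M" for M :: "real^3^3"
      by (simp add: det_3 power3_eq_cube algebra_simps)
    then show ?thesis using det[of "mat 1"] det_SO3_mult[OF PQ, of "mat 1"] unfolding F1 by simp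
  qed
  ultimately have c: "c = 1" by (simp add: power3_eq_cube)
  from alt show ?thesis
  proof
    assume "\<forall>X. ?F X = c *\<^sub>R (P ** X ** transpose Q)"
    then have "A = rho (P, Q)" by (intro matrix_action_eqI) (simp add: c matrix_action_rho PQ)
    then show ?thesis using that PQ by blast
  next
    assume F': "\<forall>X. ?F X = c *\<^sub>R (P ** transpose X ** transpose Q)"
    have "matrix_action (rho (P, Q) ** transposition9) X
      = matrix_action (rho (P, Q)) (matrix_action transposition9 X)" for X
      by (simp add: matrix_action_def matrix_vector_mul_assoc)
    then have "A = rho (P, Q) ** transposition9"
      using F' by (intro matrix_action_eqI) (simp add: c matrix_action_rho PQ matrix_action_transposition9)
    then show ?thesis using that PQ by blast
  qed
qed

text \<open>On \<open>\<real>\<^sup>9\<close> the transposition exchanges three pairs of coordinates.\<close>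

lemma det_transposition9: "det transposition9 = - 1"
proof -
  let ?t = "Transposition.transpose :: 9 \<Rightarrow> 9 \<Rightarrow> 9 \<Rightarrow> 9"
  define \<pi> where "\<pi> = ?t 2 4 \<circ> (?t 3 7 \<circ> ?t 6 8)"
  have "\<pi> permutes UNIV"
    unfolding \<pi>_def by (intro permutes_compose permutes_swap_id) simp_all
  have "transposition9 *v x = (\<chi> i. mat 1 $ \<pi> i) *v x" for x
  proof -
    have "((\<chi> i. mat 1 $ \<pi> i) *v x) $ i = x $ \<pi> i" for i
      by (simp add: matrix_vector_mult_def mat_def if_distrib[of "\<lambda>y. y * _"] cong: if_cong)
    then have "sigma9 ((\<chi> i. mat 1 $ \<pi> i) *v x) = transpose (sigma9 x)"
      by (simp add: vec_eq_iff forall_3 transpose_def \<pi>_def Transposition.transpose_def)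
    then show ?thesis using sigma_transposition9[of x] by (metis inj_sigma injD)
  qed
  then have "transposition9 = (\<chi> i. mat 1 $ \<pi> i)" by (simp add: matrix_eq)
  then have "det transposition9 = of_int (sign \<pi>) * det (mat 1 :: real^9^9)"
    using det_permute_rows[OF \<open>\<pi> permutes UNIV\<close>, of "mat 1 :: real^9^9"] by simp
  also have "sign \<pi> = - 1"
    by (simp add: \<pi>_def sign_compose sign_swap_id permutation_swap_id permutation_compose)
  finally show ?thesis by simp
qed

lemma det_uminus_9: "det (- A) = - det A" for A :: "real^9^9"
proof -
  have "det (mat (- 1) :: real^9^9) = (- 1) ^ 9"
    by (subst det_diagonal) (simp_all add: mat_def)
  moreover have "- A = mat (- 1) ** A"
    by (simp add: matrix_eq mat_uminus_vector flip: matrix_vector_mul_assoc)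
       (simp add: matrix_vector_mult_def vec_eq_iff sum_negf)
  ultimately show ?thesis by (simp add: det_mul)
qed

theorem proposition2p2:
  shows "inj_on rho (SO3 \<times> SO3) \<and> irreducible_matrices (rho ` (SO3 \<times> SO3))
    \<and> (connected_component_set stab_g_Upsilon (mat 1) = rho ` (SO3 \<times> SO3)
       \<and> {A \<in> stab_g_Upsilon. det A > 0} = rho ` (SO3 \<times> SO3))
    \<and> (connected_component_set stab_omega (mat 1) = rho ` (SO3 \<times> SO3)
       \<and> {A \<in> stab_omega. det A > 0} = rho ` (SO3 \<times> SO3))"
proof -
  let ?G = "rho ` (SO3 \<times> SO3)"
  have 1: "{A \<in> stab_g_Upsilon. det A > 0} = ?G"
  proof
    show "{A \<in> stab_g_Upsilon. det A > 0} \<subseteq> ?G"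
    proof
      fix A assume A: "A \<in> {A \<in> stab_g_Upsilon. det A > 0}"
      then obtain P Q where PQ: "P \<in> SO3" "Q \<in> SO3" "A = rho (P, Q) \<or> A = rho (P, Q) ** transposition9"
        using stab_g_Upsilon_cases by blast
      moreover have "A \<noteq> rho (P, Q) ** transposition9"
        using A PQ(1,2) det_rho_pos[of "(P, Q)"] by (auto simp: det_mul det_transposition9)
      ultimately show "A \<in> ?G" by blast
    qed
  qed (auto intro: rho_in_stab_g_Upsilon det_rho_pos)
  have 2: "{A \<in> stab_omega. det A > 0} = ?G"
  proof
    show "{A \<in> stab_omega. det A > 0} \<subseteq> ?G"
    proof
      fix A assume A: "A \<in> {A \<in> stab_omega. det A > 0}"
      then obtain P Q where PQ: "P \<in> SO3" "Q \<in> SO3" "A = rho (P, Q) \<or> A = - rho (P, Q)"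
        using stab_omega_cases by blast
      moreover have "A \<noteq> - rho (P, Q)"
        using A PQ(1,2) det_rho_pos[of "(P, Q)"] by (auto simp: det_uminus_9)
      ultimately show "A \<in> ?G" by blast
    qed
  qed (auto intro: rho_in_stab_omega det_rho_pos)
  have "stab_g_Upsilon \<subseteq> GL9" "stab_omega \<subseteq> GL9" by (auto simp: stab_g_Upsilon_def stab_omega_def)
  then have "connected_component_set stab_g_Upsilon (mat 1) = ?G"
    "connected_component_set stab_omega (mat 1) = ?G"
    using identity_component_eq 1 2 connected_rho mat_1_rho by blast+
  then show ?thesis using inj_on_rho irreducible_rho 1 2 by blast
qed

end
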